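(* Let $\mathcal{H}$ be a Hilbert space, let $\varphi$ be a state on $B(\mathcal{H})$, and let $T_1,\dots,T_n\in B(\mathcal{H})$ be contractions that are tensor independent in $(B(\mathcal{H}),\varphi)$. Then there exist a Hilbert space $\mathcal{K}$ containing $\mathcal{H}$ and unitaries $U_1,\dots,U_n\in B(\mathcal{K})$ that are tensor independent with respect to the state $\psi=\varphi\circ\operatorname{ad}_{P_{\mathcal{H}}}$ on $B(\mathcal{K})$, such that for all $k_1,\dots,k_n\in\mathbb{Z}$ \[ T_1(k_1)\cdots T_n(k_n)=P_{\mathcal{H}}U_1^{k_1}\cdots U_n^{k_n}|_{\mathcal{H}},\qquad\text{where } T(k)=\begin{cases}T^k,& k\ge 0\\ (T^* )^{-k},& k<0.\end{cases} \] Furthermore, this dilation is unique up to unitary equivalence when $\mathcal{K}$ is minimal, meaning that $\mathcal{K}$ is the smallest reducing subspace of $U_1,\dots,U_n$ containing $\mathcal{H}$.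
   Context: For an operator $T$, $C^*(1,T)$ is the unital C$^*$-algebra generated by $T$. $P_{\mathcal{H}}$ is the orthogonal projection of $\mathcal{K}$ onto the closed subspace $\mathcal{H}$, and $\operatorname{ad}_{P_{\mathcal{H}}}:B(\mathcal{K})\to B(\mathcal{H})$ is the compression $a\mapsto P_{\mathcal{H}}a|_{\mathcal{H}}$, so $\psi(a)=\varphi(P_{\mathcal{H}}a|_{\mathcal{H}})$. A non-commutative C$^*$-probability space $(\mathcal{A},\varphi)$ is a unital C$^*$-algebra $\mathcal{A}$ with a state $\varphi$. Operators $T_1,\dots,T_n\in\mathcal{A}$ are tensor independent in $(\mathcal{A},\varphi)$ (or with respect to $\varphi$) if the algebras $C^*(1,T_1),\dots,C^*(1,T_n)$ pairwise commute and $\varphi\left(\prod_{i=1}^n a_i\right)=\prod_{i=1}^n\varphi(a_i)$ whenever $a_i\in C^*(1,T_i)$ for $1\le i\le n$. Unique up to unitary equivalence means: given two such minimal dilations $U_1,\dots,U_n$ on $\mathcal{K}$ and $U_1',\dots,U_n'$ on $\mathcal{K}'$, there is a unitary $\Theta:\mathcal{K}\to\mathcal{K}'$ with $\Theta h=h$ for all $h\in\mathcal{H}$ and $\Theta U_i=U_i'\Theta$ for all $i$. *)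

theory Defs
  imports "HOL-Analysis.Analysis"
begin

section \<open>Complex Hilbert spaces\<close>

text \<open>
  A complex inner product space is a real one (so that norm and topology are the library's)
  together with a complex scalar multiplication and a complex inner product, linear in the first
  argument, whose real part is the real inner product.
\<close>

class scaleC =
  fixes scaleC :: "complex \<Rightarrow> 'a \<Rightarrow> 'a"  (infixr \<open>*\<^sub>C\<close> 75)

class complex_inner = real_inner + scaleC +
  fixes cinner :: "'a \<Rightarrow> 'a \<Rightarrow> complex"
  assumes scaleC_add_right: "c *\<^sub>C (x + y) = c *\<^sub>C x + c *\<^sub>C y"
    and scaleC_add_left: "(c + d) *\<^sub>C x = c *\<^sub>C x + d *\<^sub>C x"
    and scaleC_scaleC: "c *\<^sub>C d *\<^sub>C x = (c * d) *\<^sub>C x"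
    and scaleR_scaleC: "r *\<^sub>R x = complex_of_real r *\<^sub>C x"
    and cinner_add_left: "cinner (x + y) z = cinner x z + cinner y z"
    and cinner_scaleC_left: "cinner (c *\<^sub>C x) y = c * cinner x y"
    and cinner_commute: "cinner x y = cnj (cinner y x)"
    and inner_eq_Re_cinner: "inner x y = Re (cinner x y)"

class complex_hilbert = complex_inner + complete_space

lemma cinner_scaleC_right:
  fixes x y :: "'a::complex_inner"
  shows "cinner x (c *\<^sub>C y) = cnj c * cinner x y"
  by (metis cinner_commute cinner_scaleC_left complex_cnj_mult)

lemma norm_scaleC:
  fixes x :: "'a::complex_inner"
  shows "norm (c *\<^sub>C x) = cmod c * norm x"
proof -
  have "cinner (c *\<^sub>C x) (c *\<^sub>C x) = (c * cnj c) * cinner x x"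
    by (simp only: cinner_scaleC_left cinner_scaleC_right mult.assoc mult.left_commute)
  also have "\<dots> = complex_of_real ((cmod c)\<^sup>2) * cinner x x"
    by (simp only: complex_norm_square)
  finally have "inner (c *\<^sub>C x) (c *\<^sub>C x) = (cmod c)\<^sup>2 * inner x x"
    by (simp add: inner_eq_Re_cinner del: of_real_power)
  then show ?thesis
    by (simp add: norm_eq_sqrt_inner real_sqrt_mult)
qed

lemma cmod_cinner_le:
  fixes x y :: "'a::complex_inner"
  shows "cmod (cinner x y) \<le> 2 * (norm x * norm y)"
proof -
  have "\<bar>Re (cinner x y)\<bar> \<le> norm x * norm y"
    using Cauchy_Schwarz_ineq2[of x y] by (simp add: inner_eq_Re_cinner)
  moreover have "\<bar>Im (cinner x y)\<bar> \<le> norm x * norm y"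
    using Cauchy_Schwarz_ineq2[of "\<i> *\<^sub>C x" y]
    by (simp add: inner_eq_Re_cinner cinner_scaleC_left norm_scaleC)
  ultimately show ?thesis
    using cmod_le[of "cinner x y"] by linarith
qed

instantiation complex :: complex_hilbert
begin

definition "scaleC_complex (c::complex) (x::complex) = c * x"
definition "cinner_complex (x::complex) (y::complex) = x * cnj y"

instance
  by standard (auto simp: scaleC_complex_def cinner_complex_def inner_complex_def algebra_simps
      scaleR_conv_of_real)

end

section \<open>The Hilbert space of square-summable families\<close>

text \<open>
  \<open>('i, 'a) ell2\<close> is the Hilbert space direct sum of copies of \<open>'a\<close> indexed by \<open>'i\<close>.
  HOL cannot quantify existentially over types, so the dilation space is asserted to exist
  on a concrete type, and this is a type large enough to contain one.
\<close>

definition square_summable :: "('i \<Rightarrow> 'a::real_normed_vector) \<Rightarrow> bool"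
  where "square_summable f \<longleftrightarrow> (\<lambda>i. (norm (f i))\<^sup>2) summable_on UNIV"

lemma square_summable_add:
  assumes "square_summable f" "square_summable g"
  shows "square_summable (\<lambda>i. f i + g i)"
proof -
  have *: "(norm (f i + g i))\<^sup>2 \<le> 2 * (norm (f i))\<^sup>2 + 2 * (norm (g i))\<^sup>2" for i
  proof -
    have "(norm (f i + g i))\<^sup>2 \<le> (norm (f i) + norm (g i))\<^sup>2"
      by (simp add: norm_triangle_ineq power_mono)
    also have "\<dots> \<le> 2 * (norm (f i))\<^sup>2 + 2 * (norm (g i))\<^sup>2"
      using zero_le_power2[of "norm (f i) - norm (g i)"] by (simp add: power2_diff power2_sum)
    finally show ?thesis .
  qed
  have "(\<lambda>i. 2 * (norm (f i))\<^sup>2 + 2 * (norm (g i))\<^sup>2) summable_on UNIV"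
    using assms unfolding square_summable_def
    by (intro summable_on_add summable_on_cmult_right)
  then show ?thesis
    unfolding square_summable_def by (rule summable_on_comparison_test) (use * in auto)
qed

lemma square_summable_scale:
  assumes "square_summable f" "\<And>i. norm (g i) = c * norm (f i)"
  shows "square_summable g"
  using assms unfolding square_summable_def
  by (simp add: power_mult_distrib summable_on_cmult_right)

lemma summable_on_norm_mult:
  assumes "square_summable f" "square_summable g"
  shows "(\<lambda>i. norm (f i) * norm (g i)) summable_on UNIV"
proof -
  have "(\<lambda>i. (norm (f i))\<^sup>2 + (norm (g i))\<^sup>2) summable_on UNIV"
    using assms unfolding square_summable_def by (rule summable_on_add)
  then show ?thesis
  proof (rule summable_on_comparison_test)
    show "norm (f i) * norm (g i) \<le> (norm (f i))\<^sup>2 + (norm (g i))\<^sup>2" for i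
      using sum_squares_bound[of "norm (f i)" "norm (g i)"]
        mult_nonneg_nonneg[OF norm_ge_zero[of "f i"] norm_ge_zero[of "g i"]] by linarith
  qed auto
qed

lemma summable_on_inner:
  fixes f g :: "'i \<Rightarrow> 'a::real_inner"
  assumes "square_summable f" "square_summable g"
  shows "(\<lambda>i. inner (f i) (g i)) summable_on UNIV"
  by (rule abs_summable_summable, rule Infinite_Sum.abs_summable_on_comparison_test'[OF summable_on_norm_mult[OF assms]])
     (simp add: Cauchy_Schwarz_ineq2)

lemma summable_on_cinner:
  fixes f g :: "'i \<Rightarrow> 'a::complex_inner"
  assumes "square_summable f" "square_summable g"
  shows "(\<lambda>i. cinner (f i) (g i)) summable_on UNIV"
  by (rule abs_summable_summable, rule Infinite_Sum.abs_summable_on_comparison_test'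
      [OF summable_on_cmult_right[OF summable_on_norm_mult[OF assms], of 2]])
     (simp add: cmod_cinner_le)

typedef (overloaded) ('i, 'a) ell2 = "{f :: 'i \<Rightarrow> 'a::complex_inner. square_summable f}"
  morphisms ell2_apply Abs_ell2
  by (rule exI[of _ "\<lambda>_. 0"]) (simp add: square_summable_def)

setup_lifting type_definition_ell2

lemma square_summable_ell2 [simp]: "square_summable (ell2_apply x)"
  using ell2_apply by auto

instantiation ell2 :: (type, complex_inner) complex_inner
begin

lift_definition zero_ell2 :: "('a, 'b) ell2" is "\<lambda>_. 0"
  by (simp add: square_summable_def)

lift_definition plus_ell2 :: "('a, 'b) ell2 \<Rightarrow> ('a, 'b) ell2 \<Rightarrow> ('a, 'b) ell2"
  is "\<lambda>f g i. f i + g i"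
  by (rule square_summable_add)

lift_definition uminus_ell2 :: "('a, 'b) ell2 \<Rightarrow> ('a, 'b) ell2" is "\<lambda>f i. - f i"
  by (erule square_summable_scale[where c = 1]) simp

lift_definition minus_ell2 :: "('a, 'b) ell2 \<Rightarrow> ('a, 'b) ell2 \<Rightarrow> ('a, 'b) ell2"
  is "\<lambda>f g i. f i - g i"
  subgoal for f g
    using square_summable_add[of f "\<lambda>i. - g i"] square_summable_scale[of g "\<lambda>i. - g i" 1]
    by simp
  done

lift_definition scaleR_ell2 :: "real \<Rightarrow> ('a, 'b) ell2 \<Rightarrow> ('a, 'b) ell2"
  is "\<lambda>r f i. r *\<^sub>R f i"
  by (erule square_summable_scale) (rule norm_scaleR)

lift_definition scaleC_ell2 :: "complex \<Rightarrow> ('a, 'b) ell2 \<Rightarrow> ('a, 'b) ell2"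
  is "\<lambda>c f i. c *\<^sub>C f i"
  by (erule square_summable_scale) (rule norm_scaleC)

lift_definition inner_ell2 :: "('a, 'b) ell2 \<Rightarrow> ('a, 'b) ell2 \<Rightarrow> real"
  is "\<lambda>f g. \<Sum>\<^sub>\<infinity>i. inner (f i) (g i)" .

lift_definition cinner_ell2 :: "('a, 'b) ell2 \<Rightarrow> ('a, 'b) ell2 \<Rightarrow> complex"
  is "\<lambda>f g. \<Sum>\<^sub>\<infinity>i. cinner (f i) (g i)" .

definition norm_ell2 :: "('a, 'b) ell2 \<Rightarrow> real"
  where "norm_ell2 x = sqrt (inner x x)"

definition sgn_ell2 :: "('a, 'b) ell2 \<Rightarrow> ('a, 'b) ell2"
  where "sgn_ell2 x = inverse (norm x) *\<^sub>R x"

definition dist_ell2 :: "('a, 'b) ell2 \<Rightarrow> ('a, 'b) ell2 \<Rightarrow> real"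
  where "dist_ell2 x y = norm (x - y)"

definition uniformity_ell2 :: "(('a, 'b) ell2 \<times> ('a, 'b) ell2) filter"
  where "uniformity_ell2 = (INF e\<in>{0 <..}. principal {(x, y). dist x y < e})"

definition open_ell2 :: "('a, 'b) ell2 set \<Rightarrow> bool"
  where "open_ell2 S = (\<forall>x\<in>S. \<forall>\<^sub>F (x', y) in uniformity. x' = x \<longrightarrow> y \<in> S)"

instance
proof
  fix x y z :: "('a, 'b) ell2" and r s :: real and c d :: complex
  show "x + y + z = x + (y + z)" by transfer (simp add: add.assoc)
  show "x + y = y + x" by transfer (simp add: add.commute)
  show "0 + x = x" by transfer simp
  show "- x + x = 0" by transfer simp
  show "x - y = x + - y" by transfer simp
  show "r *\<^sub>R (x + y) = r *\<^sub>R x + r *\<^sub>R y" by transfer (simp add: scaleR_right_distrib)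
  show "(r + s) *\<^sub>R x = r *\<^sub>R x + s *\<^sub>R x" by transfer (simp add: scaleR_left_distrib)
  show "r *\<^sub>R s *\<^sub>R x = (r * s) *\<^sub>R x" by transfer simp
  show "1 *\<^sub>R x = x" by transfer simp
  show "sgn x = inverse (norm x) *\<^sub>R x" by (rule sgn_ell2_def)
  show "dist x y = norm (x - y)" by (rule dist_ell2_def)
  show "uniformity = (INF e\<in>{0 <..}. principal {(x, y). dist (x :: ('a, 'b) ell2) y < e})"
    by (rule uniformity_ell2_def)
  show "open U = (\<forall>x\<in>U. \<forall>\<^sub>F (x', y) in uniformity. x' = x \<longrightarrow> y \<in> U)"
    for U :: "('a, 'b) ell2 set"
    by (rule open_ell2_def)
  show "inner x y = inner y x" by transfer (simp add: inner_commute)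
  show "inner (x + y) z = inner x z + inner y z"
    by transfer (simp add: inner_add_left infsum_add summable_on_inner)
  show "inner (r *\<^sub>R x) y = r * inner x y"
    by transfer (simp add: infsum_cmult_right summable_on_inner)
  show "0 \<le> inner x x" by transfer (simp add: infsum_nonneg)
  show "inner x x = 0 \<longleftrightarrow> x = 0"
  proof transfer
    fix f :: "'a \<Rightarrow> 'b"
    assume f: "square_summable f"
    have zero: "f i = 0" if *: "(\<Sum>\<^sub>\<infinity>i. inner (f i) (f i)) = 0" for i
    proof -
      have "inner (f i) (f i) = 0"
        by (rule nonneg_infsum_le_0D[where A = UNIV])
           (use * summable_on_inner[OF f f] in simp_all)
      then show ?thesis by simp
    qed
    show "(\<Sum>\<^sub>\<infinity>i. inner (f i) (f i)) = 0 \<longleftrightarrow> f = (\<lambda>_. 0)"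
    proof (intro iffI ext)
      show "f i = 0" if "(\<Sum>\<^sub>\<infinity>i. inner (f i) (f i)) = 0" for i
        using that by (rule zero)
    qed simp
  qed
  show "norm x = sqrt (inner x x)" by (rule norm_ell2_def)
  show "c *\<^sub>C (x + y) = c *\<^sub>C x + c *\<^sub>C y" by transfer (simp add: scaleC_add_right)
  show "(c + d) *\<^sub>C x = c *\<^sub>C x + d *\<^sub>C x" by transfer (simp add: scaleC_add_left)
  show "c *\<^sub>C d *\<^sub>C x = (c * d) *\<^sub>C x" by transfer (simp add: scaleC_scaleC)
  show "r *\<^sub>R x = complex_of_real r *\<^sub>C x" by transfer (simp add: scaleR_scaleC)
  show "cinner (x + y) z = cinner x z + cinner y z"
    by transfer (simp add: cinner_add_left infsum_add summable_on_cinner)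
  show "cinner (c *\<^sub>C x) y = c * cinner x y"
    by transfer (simp add: cinner_scaleC_left infsum_cmult_right summable_on_cinner)
  show "cinner x y = cnj (cinner y x)"
    by transfer (subst infsum_cnj[symmetric], rule infsum_cong, rule cinner_commute)
  show "inner x y = Re (cinner x y)"
    by transfer (simp add: inner_eq_Re_cinner infsum_Re summable_on_cinner)
qed

end

lemma norm_ell2_power2: "(norm x)\<^sup>2 = (\<Sum>\<^sub>\<infinity>i. (norm (ell2_apply x i))\<^sup>2)"
  by (simp add: power2_norm_eq_inner inner_ell2.rep_eq)

lemma sum_le_norm_ell2:
  assumes "finite F"
  shows "(\<Sum>i\<in>F. (norm (ell2_apply x i))\<^sup>2) \<le> (norm x)\<^sup>2"
  unfolding norm_ell2_power2
  by (rule finite_sum_le_infsum) (use assms square_summable_ell2[of x] in \<open>auto simp: square_summable_def\<close>)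

lemma norm_ell2_apply_le: "norm (ell2_apply x i) \<le> norm x"
  using sum_le_norm_ell2[of "{i}" x] by (simp add: power2_le_iff_abs_le)

instance ell2 :: (type, complex_hilbert) complex_hilbert
proof
  fix X :: "nat \<Rightarrow> ('a, 'b) ell2"
  assume X: "Cauchy X"
  have "Cauchy (\<lambda>n. ell2_apply (X n) i)" for i
  proof (rule metric_CauchyI)
    fix e :: real
    assume "e > 0"
    then obtain N where N: "\<And>m n. m \<ge> N \<Longrightarrow> n \<ge> N \<Longrightarrow> dist (X m) (X n) < e"
      using metric_CauchyD[OF X] by blast
    have "dist (ell2_apply (X m) i) (ell2_apply (X n) i) < e" if "m \<ge> N" "n \<ge> N" for m n
      using N[OF that] norm_ell2_apply_le[of "X m - X n" i]
      by (simp add: dist_norm minus_ell2.rep_eq)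
    then show "\<exists>N. \<forall>m\<ge>N. \<forall>n\<ge>N. dist (ell2_apply (X m) i) (ell2_apply (X n) i) < e"
      by blast
  qed
  then have "\<exists>l. (\<lambda>n. ell2_apply (X n) i) \<longlonglongrightarrow> l" for i
    using Cauchy_convergent convergent_def by blast
  then obtain f where f: "\<And>i. (\<lambda>n. ell2_apply (X n) i) \<longlonglongrightarrow> f i"
    by metis
  have key: "\<exists>N. \<forall>n\<ge>N. \<forall>F. finite F \<longrightarrow> (\<Sum>i\<in>F. (norm (ell2_apply (X n) i - f i))\<^sup>2) \<le> e\<^sup>2"
    if "e > 0" for e
  proof -
    obtain N where N: "\<And>m n. m \<ge> N \<Longrightarrow> n \<ge> N \<Longrightarrow> dist (X m) (X n) < e"
      using metric_CauchyD[OF X \<open>e > 0\<close>] by blast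
    have "(\<Sum>i\<in>F. (norm (ell2_apply (X n) i - f i))\<^sup>2) \<le> e\<^sup>2" if "n \<ge> N" "finite F" for n F
    proof (rule LIMSEQ_le_const2)
      show "(\<lambda>m. \<Sum>i\<in>F. (norm (ell2_apply (X n) i - ell2_apply (X m) i))\<^sup>2)
          \<longlonglongrightarrow> (\<Sum>i\<in>F. (norm (ell2_apply (X n) i - f i))\<^sup>2)"
        by (intro tendsto_intros f)
      have "(\<Sum>i\<in>F. (norm (ell2_apply (X n) i - ell2_apply (X m) i))\<^sup>2) \<le> e\<^sup>2" if "m \<ge> N" for m
      proof -
        have "(\<Sum>i\<in>F. (norm (ell2_apply (X n) i - ell2_apply (X m) i))\<^sup>2) \<le> (norm (X n - X m))\<^sup>2"
          using sum_le_norm_ell2[OF \<open>finite F\<close>, of "X n - X m"] by (simp add: minus_ell2.rep_eq)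
        also have "\<dots> \<le> e\<^sup>2"
          using N[OF \<open>n \<ge> N\<close> \<open>m \<ge> N\<close>] by (intro power_mono) (auto simp: dist_norm)
        finally show ?thesis .
      qed
      then show "\<exists>M. \<forall>m\<ge>M. (\<Sum>i\<in>F. (norm (ell2_apply (X n) i - ell2_apply (X m) i))\<^sup>2) \<le> e\<^sup>2"
        by blast
    qed
    then show ?thesis by blast
  qed
  have diff: "square_summable (\<lambda>i. ell2_apply (X n) i - f i)"
    if "\<forall>F. finite F \<longrightarrow> (\<Sum>i\<in>F. (norm (ell2_apply (X n) i - f i))\<^sup>2) \<le> B" for n B
    unfolding square_summable_def
    by (rule nonneg_bdd_above_summable_on) (use that in \<open>auto simp: bdd_above_def\<close>)
  have "square_summable f"
  proof -
    obtain n where "\<forall>F. finite F \<longrightarrow> (\<Sum>i\<in>F. (norm (ell2_apply (X n) i - f i))\<^sup>2) \<le> 1\<^sup>2"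
      using key[of 1] by auto
    from square_summable_add[OF square_summable_ell2[of "X n"]
        square_summable_scale[OF diff[OF this], where c = 1 and g = "\<lambda>i. f i - ell2_apply (X n) i"]]
    show ?thesis by (simp add: norm_minus_commute)
  qed
  then have L: "ell2_apply (Abs_ell2 f) = f"
    by (simp add: Abs_ell2_inverse)
  have "X \<longlonglongrightarrow> Abs_ell2 f"
  proof (rule metric_LIMSEQ_I)
    fix e :: real
    assume "e > 0"
    then obtain N where N:
      "\<And>n F. n \<ge> N \<Longrightarrow> finite F \<Longrightarrow> (\<Sum>i\<in>F. (norm (ell2_apply (X n) i - f i))\<^sup>2) \<le> (e / 2)\<^sup>2"
      using key[of "e / 2"] by auto
    have "dist (X n) (Abs_ell2 f) < e" if "n \<ge> N" for n
    proof -
      have "(norm (X n - Abs_ell2 f))\<^sup>2 \<le> (e / 2)\<^sup>2"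
        unfolding norm_ell2_power2
        by (rule infsum_le_finite_sums)
           (use N[OF that] diff[of n "(e / 2)\<^sup>2"] in \<open>auto simp: minus_ell2.rep_eq L square_summable_def\<close>)
      then have "norm (X n - Abs_ell2 f) \<le> e / 2"
        using \<open>e > 0\<close> by (simp add: power2_le_iff_abs_le)
      then show ?thesis
        using \<open>e > 0\<close> by (simp add: dist_norm)
    qed
    then show "\<exists>N. \<forall>n\<ge>N. dist (X n) (Abs_ell2 f) < e" by blast
  qed
  then show "convergent X" by (auto simp: convergent_def)
qed

section \<open>Bounded operators\<close>

text \<open>
  The library type of bounded linear maps consists of the bounded \<^emph>\<open>real\<close>-linear ones.  The bounded
  complex-linear maps form its subset \<open>bop\<close>; in particular \<open>B(\<H>)\<close> is \<open>bop\<close> at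
  type \<^typ>\<open>'h \<Rightarrow>\<^sub>L 'h\<close>, with the operator norm of that type.
\<close>

definition bop :: "('a::complex_hilbert \<Rightarrow>\<^sub>L 'b::complex_hilbert) set"
  where "bop = {a. \<forall>c x. blinfun_apply a (c *\<^sub>C x) = c *\<^sub>C blinfun_apply a x}"

instantiation blinfun :: (real_normed_vector, complex_hilbert) scaleC
begin

definition scaleC_blinfun :: "complex \<Rightarrow> ('a \<Rightarrow>\<^sub>L 'b) \<Rightarrow> 'a \<Rightarrow>\<^sub>L 'b"
  where "c *\<^sub>C a = Blinfun (\<lambda>x. c *\<^sub>C blinfun_apply a x)"

instance ..

end

definition adj :: "('a::complex_hilbert \<Rightarrow>\<^sub>L 'b::complex_hilbert) \<Rightarrow> 'b \<Rightarrow>\<^sub>L 'a"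
  where "adj a = (THE b. \<forall>x y. cinner (blinfun_apply a x) y = cinner x (blinfun_apply b y))"

definition unitary_op :: "('a::complex_hilbert \<Rightarrow>\<^sub>L 'b::complex_hilbert) \<Rightarrow> bool"
  where "unitary_op U \<longleftrightarrow>
    U \<in> bop \<and> adj U o\<^sub>L U = id_blinfun \<and> U o\<^sub>L adj U = id_blinfun"

definition isometry_op :: "('a::complex_hilbert \<Rightarrow>\<^sub>L 'b::complex_hilbert) \<Rightarrow> bool"
  where "isometry_op V \<longleftrightarrow>
    V \<in> bop \<and> (\<forall>x y. cinner (blinfun_apply V x) (blinfun_apply V y) = cinner x y)"

primrec op_power :: "('a::real_normed_vector \<Rightarrow>\<^sub>L 'a) \<Rightarrow> nat \<Rightarrow> 'a \<Rightarrow>\<^sub>L 'a"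
  where
    "op_power a 0 = id_blinfun"
  | "op_power a (Suc m) = a o\<^sub>L op_power a m"

definition op_inverse :: "('a::real_normed_vector \<Rightarrow>\<^sub>L 'a) \<Rightarrow> 'a \<Rightarrow>\<^sub>L 'a"
  where "op_inverse a = (THE b. b o\<^sub>L a = id_blinfun \<and> a o\<^sub>L b = id_blinfun)"

text \<open>Integer powers \<open>U\<^sup>k\<close> of an invertible operator, and the powers \<open>T(k)\<close> of a contraction.\<close>

definition op_zpower :: "('a::real_normed_vector \<Rightarrow>\<^sub>L 'a) \<Rightarrow> int \<Rightarrow> 'a \<Rightarrow>\<^sub>L 'a"
  where "op_zpower U k =
    (if k \<ge> 0 then op_power U (nat k) else op_power (op_inverse U) (nat (- k)))"

definition star_power :: "('a::complex_hilbert \<Rightarrow>\<^sub>L 'a) \<Rightarrow> int \<Rightarrow> 'a \<Rightarrow>\<^sub>L 'a"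
  where "star_power T k =
    (if k \<ge> 0 then op_power T (nat k) else op_power (adj T) (nat (- k)))"

definition oprod :: "nat \<Rightarrow> (nat \<Rightarrow> 'a::real_normed_vector \<Rightarrow>\<^sub>L 'a) \<Rightarrow> 'a \<Rightarrow>\<^sub>L 'a"
  \<comment> \<open>the ordered product \<open>A 1 \<cdots> A n\<close>\<close>
  where "oprod n A = foldr (\<lambda>i b. A i o\<^sub>L b) [1..<Suc n] id_blinfun"

section \<open>States, generated C*-algebras and tensor independence\<close>

definition op_state :: "(('a::complex_hilbert \<Rightarrow>\<^sub>L 'a) \<Rightarrow> complex) \<Rightarrow> bool"
  where "op_state \<phi> \<longleftrightarrow>
    (\<forall>a\<in>bop. \<forall>b\<in>bop. \<phi> (a + b) = \<phi> a + \<phi> b) \<and>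
    (\<forall>a\<in>bop. \<forall>c. \<phi> (c *\<^sub>C a) = c * \<phi> a) \<and>
    (\<forall>a\<in>(bop :: ('a \<Rightarrow>\<^sub>L 'a) set). \<phi> (adj a o\<^sub>L a) \<in> \<real>\<^sub>\<ge>\<^sub>0) \<and>
    \<phi> id_blinfun = 1"

definition unital_cstar_algebra :: "('a::complex_hilbert \<Rightarrow>\<^sub>L 'a) set \<Rightarrow> bool"
  where "unital_cstar_algebra A \<longleftrightarrow>
    A \<subseteq> bop \<and> id_blinfun \<in> A \<and>
    (\<forall>a\<in>A. \<forall>b\<in>A. a + b \<in> A \<and> a o\<^sub>L b \<in> A) \<and>
    (\<forall>a\<in>A. adj a \<in> A \<and> (\<forall>c. c *\<^sub>C a \<in> A)) \<and>
    closed A"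

definition cstar_generated :: "('a::complex_hilbert \<Rightarrow>\<^sub>L 'a) \<Rightarrow> ('a \<Rightarrow>\<^sub>L 'a) set"
  where "cstar_generated T = unital_cstar_algebra hull {T}"

definition tensor_independent ::
    "(('a::complex_hilbert \<Rightarrow>\<^sub>L 'a) \<Rightarrow> complex) \<Rightarrow> nat \<Rightarrow> (nat \<Rightarrow> 'a \<Rightarrow>\<^sub>L 'a) \<Rightarrow> bool"
  where "tensor_independent \<phi> n T \<longleftrightarrow>
    (\<forall>i\<in>{1..n}. \<forall>j\<in>{1..n}. i \<noteq> j \<longrightarrow>
      (\<forall>a\<in>cstar_generated (T i). \<forall>b\<in>cstar_generated (T j). a o\<^sub>L b = b o\<^sub>L a)) \<and>
    (\<forall>a. (\<forall>i\<in>{1..n}. a i \<in> cstar_generated (T i)) \<longrightarrow>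
      \<phi> (oprod n a) = (\<Prod>i\<in>{1..n}. \<phi> (a i)))"

section \<open>Dilations\<close>

definition orth_proj :: "'a::complex_hilbert set \<Rightarrow> 'a \<Rightarrow> 'a"
  where "orth_proj S x = (THE y. y \<in> S \<and> (\<forall>z\<in>S. cinner (x - y) z = 0))"

text \<open>
  A Hilbert space \<open>\<K>\<close> containing \<open>\<H>\<close> is given by an isometry \<open>V : \<H> \<rightarrow> \<K>\<close>, which identifies \<open>\<H>\<close> with
  the closed subspace \<open>range V\<close>.  Under this identification \<open>compression V\<close> is the map
  \<open>a \<mapsto> P a|\<close> from \<open>B(\<K>)\<close> to \<open>B(\<H>)\<close>, where \<open>P\<close> is the orthogonal projection onto \<open>range V\<close>.
\<close>

definition compression ::
    "('h::complex_hilbert \<Rightarrow>\<^sub>L 'k::complex_hilbert) \<Rightarrow> ('k \<Rightarrow>\<^sub>L 'k) \<Rightarrow> 'h \<Rightarrow>\<^sub>L 'h"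
  where "compression V a = Blinfun (\<lambda>h.
    inv (blinfun_apply V)
      (orth_proj (range (blinfun_apply V)) (blinfun_apply a (blinfun_apply V h))))"

definition tensor_dilation ::
    "(('h::complex_hilbert \<Rightarrow>\<^sub>L 'h) \<Rightarrow> complex) \<Rightarrow> nat \<Rightarrow> (nat \<Rightarrow> 'h \<Rightarrow>\<^sub>L 'h) \<Rightarrow>
     ('h \<Rightarrow>\<^sub>L 'k::complex_hilbert) \<Rightarrow> (nat \<Rightarrow> 'k \<Rightarrow>\<^sub>L 'k) \<Rightarrow> bool"
  where "tensor_dilation \<phi> n T V U \<longleftrightarrow>
    isometry_op V \<and>
    (\<forall>i\<in>{1..n}. unitary_op (U i)) \<and>
    op_state (\<phi> \<circ> compression V) \<and>
    tensor_independent (\<phi> \<circ> compression V) n U \<and>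
    (\<forall>k :: nat \<Rightarrow> int.
      oprod n (\<lambda>i. star_power (T i) (k i)) = compression V (oprod n (\<lambda>i. op_zpower (U i) (k i))))"

definition reducing_subspace :: "nat \<Rightarrow> (nat \<Rightarrow> 'k::complex_hilbert \<Rightarrow>\<^sub>L 'k) \<Rightarrow> 'k set \<Rightarrow> bool"
  where "reducing_subspace n U M \<longleftrightarrow>
    closed M \<and> 0 \<in> M \<and> (\<forall>x\<in>M. \<forall>y\<in>M. x + y \<in> M) \<and> (\<forall>c. \<forall>x\<in>M. c *\<^sub>C x \<in> M) \<and>
    (\<forall>i\<in>{1..n}. \<forall>x\<in>M. blinfun_apply (U i) x \<in> M \<and> blinfun_apply (adj (U i)) x \<in> M)"

definition minimal_dilation_space ::
    "nat \<Rightarrow> ('h::complex_hilbert \<Rightarrow>\<^sub>L 'k::complex_hilbert) \<Rightarrow> (nat \<Rightarrow> 'k \<Rightarrow>\<^sub>L 'k) \<Rightarrow> bool"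
  where "minimal_dilation_space n V U \<longleftrightarrow>
    reducing_subspace n U hull range (blinfun_apply V) = UNIV"

end

theory Submission
  imports Defs
begin

text \<open>
  Existence.  Every single contraction \<open>T\<close> has a unitary dilation given by the Schaeffer matrix, whose
  entries are \<open>0\<close>, \<open>1\<close>, \<open>T\<close>, \<open>- T\<^sup>*\<close> and the defect operators of \<open>T\<close> and \<open>T\<^sup>*\<close>.  The point is that all these
  entries belong to the C*-algebra generated by \<open>T\<close> (\<open>coeff_generated\<close>).  For tensor independent \<open>T i\<close>
  the algebras commute with each other, so on families indexed by tuples of integers the Schaeffer
  matrix of \<open>T i\<close>, acting in coordinate \<open>i\<close>, commutes with the others (\<open>schaeffer_commute\<close>).  An element
  of the algebra generated by the \<open>i\<close>-th unitary is a matrix in coordinate \<open>i\<close> with entries in the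
  algebra generated by \<open>T i\<close>.  Applied to a family that is concentrated at \<open>0\<close> in coordinate \<open>i\<close>, it
  contributes to the index \<open>0\<close> only through its \<open>(0, 0)\<close> entry.  Therefore compression to the index \<open>0\<close>
  is multiplicative on products of elements in different coordinates (\<open>compression_oprod\<close>), and this
  one fact gives both the dilation equation and the factorisation of the state.

  The defect operators require square roots.  The square root of \<open>1 - A\<close>, for \<open>A\<close> of norm at most \<open>1\<close>,
  is a norm limit of polynomials in \<open>A\<close> (\<open>sqrt_iter_tendsto\<close>); this needs no spectral theory.  The same
  square root shows that the compressed functional is positive (\<open>op_state_compression\<close>).  The
  prerequisite theory of adjoints starts from a direct proof of the Riesz representation theorem.

  Uniqueness.  The inner product of \<open>U\<^sup>k V h\<close> and \<open>U\<^sup>l V h'\<close> is determined by the compression of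
  \<open>U\<^sup>l\<^sup>-\<^sup>k\<close>, that is, by the operators \<open>T i\<close> (\<open>dilation_Gram\<close>).  So matching these vectors for two
  dilations gives an isometric relation; its closed linear span is the graph of a unitary as soon as
  its domain and range are everything, and that is minimality.
\<close>

section \<open>Inner products and bounded operators\<close>

lemma cinner_add_right: "cinner x (y + z) = cinner x y + cinner (x::'a::complex_inner) z"
  by (metis cinner_add_left cinner_commute complex_cnj_add)

lemma scaleC_zero_right [simp]: "c *\<^sub>C (0::'a::complex_inner) = 0"
  by (metis add_cancel_right_left scaleC_add_right)

lemma scaleC_minus_right: "c *\<^sub>C (- x) = - (c *\<^sub>C (x::'a::complex_inner))"
  by (metis add_eq_0_iff scaleC_add_right scaleC_zero_right)

lemma scaleC_diff_right: "c *\<^sub>C (x - y) = c *\<^sub>C x - c *\<^sub>C (y::'a::complex_inner)"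
  by (metis add_uminus_conv_diff scaleC_add_right scaleC_minus_right)

lemma scaleC_left_commute: "c *\<^sub>C d *\<^sub>C x = d *\<^sub>C c *\<^sub>C (x::'a::complex_inner)"
  by (simp add: scaleC_scaleC mult.commute)

lemma bounded_linear_scaleC: "bounded_linear (\<lambda>x::'a::complex_inner. c *\<^sub>C x)"
  by (rule bounded_linear_intro[where K = "cmod c"])
     (auto simp: scaleC_add_right scaleR_scaleC norm_scaleC scaleC_left_commute)

lemma cinner_self: "cinner x x = complex_of_real ((norm (x::'a::complex_inner))\<^sup>2)"
proof (rule complex_eqI)
  show "Im (cinner x x) = Im (complex_of_real ((norm x)\<^sup>2))"
    by (metis Im_complex_of_real Reals_cnj_iff cinner_commute complex_is_Real_iff)
qed (simp add: power2_norm_eq_inner inner_eq_Re_cinner del: of_real_power)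

lemma cinner_ext:
  fixes x y :: "'a::complex_inner"
  assumes "\<And>z. cinner z x = cinner z y"
  shows "x = y"
proof -
  have "inner z x = inner z y" for z
    using assms by (simp add: inner_eq_Re_cinner)
  then show ?thesis
    by (metis inner_diff_right inner_eq_zero_iff right_minus_eq)
qed

text \<open>
  A complex inner product is determined by its real part, so a real-linear identity between real
  inner products upgrades to the complex one.
\<close>

lemma cinner_eqI_inner:
  fixes a :: "'a::complex_inner \<Rightarrow> 'b::complex_inner"
  assumes "\<And>x y. inner (a x) y = inner x (b y)" "\<And>c x. a (c *\<^sub>C x) = c *\<^sub>C a x"
  shows "cinner (a x) y = cinner x (b y)"
proof (rule complex_eqI)
  have "Im (cinner (a x) y) = - inner (a (\<i> *\<^sub>C x)) y"
    by (simp add: assms(2) inner_eq_Re_cinner cinner_scaleC_left)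
  also have "\<dots> = - inner (\<i> *\<^sub>C x) (b y)" by (simp add: assms(1))
  also have "\<dots> = Im (cinner x (b y))"
    by (simp add: inner_eq_Re_cinner cinner_scaleC_left)
  finally show "Im (cinner (a x) y) = Im (cinner x (b y))" .
qed (use assms(1)[of x y] in \<open>simp add: inner_eq_Re_cinner\<close>)

lemma bopI: "(\<And>c x. blinfun_apply a (c *\<^sub>C x) = c *\<^sub>C blinfun_apply a x) \<Longrightarrow> a \<in> bop"
  by (simp add: bop_def)

lemma bopD: "a \<in> bop \<Longrightarrow> blinfun_apply a (c *\<^sub>C x) = c *\<^sub>C blinfun_apply a x"
  by (simp add: bop_def)

lemma blinfun_apply_scaleC [simp]:
  "blinfun_apply (c *\<^sub>C a) x = c *\<^sub>C blinfun_apply (a::'a::real_normed_vector \<Rightarrow>\<^sub>L 'b::complex_hilbert) x"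
  unfolding scaleC_blinfun_def
  by (subst bounded_linear_Blinfun_apply)
     (auto intro!: bounded_linear_compose[OF bounded_linear_scaleC] blinfun.bounded_linear_right)

lemma bop_id [simp]: "id_blinfun \<in> bop"
  and bop_compose: "a \<in> bop \<Longrightarrow> b \<in> bop \<Longrightarrow> a o\<^sub>L b \<in> bop"
  and bop_add: "c \<in> bop \<Longrightarrow> d \<in> bop \<Longrightarrow> c + d \<in> bop"
  and bop_diff: "c \<in> bop \<Longrightarrow> d \<in> bop \<Longrightarrow> c - d \<in> bop"
  and bop_minus: "c \<in> bop \<Longrightarrow> - c \<in> bop"
  and bop_scaleC: "c \<in> bop \<Longrightarrow> z *\<^sub>C c \<in> bop"
  and bop_scaleR: "c \<in> bop \<Longrightarrow> r *\<^sub>R c \<in> bop"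
  and bop_zero [simp]: "0 \<in> bop"
  by (auto simp: bop_def blinfun.bilinear_simps scaleC_add_right scaleC_diff_right scaleC_minus_right
      scaleC_left_commute scaleR_scaleC)

lemma scaleR_blinfun_scaleC:
  "r *\<^sub>R (a::'a::real_normed_vector \<Rightarrow>\<^sub>L 'b::complex_hilbert) = complex_of_real r *\<^sub>C a"
  by (rule blinfun_eqI) (simp add: blinfun.bilinear_simps scaleR_scaleC)

lemma closed_bop: "closed (bop :: ('a::complex_hilbert \<Rightarrow>\<^sub>L 'b::complex_hilbert) set)"
proof -
  have "closed {a :: 'a \<Rightarrow>\<^sub>L 'b. blinfun_apply a (c *\<^sub>C x) = c *\<^sub>C blinfun_apply a x}" for c x
    by (intro closed_Collect_eq continuous_intros linear_continuous_on
        bounded_linear_compose[OF bounded_linear_scaleC] blinfun.bounded_linear_left)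
  then show ?thesis
    unfolding bop_def by (intro closed_Collect_all)
qed

section \<open>Adjoints\<close>

text \<open>
  The Riesz representation theorem by the direct method: the vector representing \<open>f\<close> minimises
  \<open>g x = \<parallel>x\<parallel>\<^sup>2 / 2 - f x\<close>.  By the parallelogram law a minimising sequence of \<open>g\<close> is Cauchy, and
  the first variation of \<open>g\<close> at its limit \<open>z\<close> is \<open>inner x z - f x\<close>.
\<close>

lemma Riesz_representation:
  fixes f :: "'a::{real_inner, complete_space} \<Rightarrow> real"
  assumes "bounded_linear f"
  shows "\<exists>z. \<forall>x. f x = inner x z"
proof -
  interpret f: bounded_linear f by fact
  define g where "g x = (norm x)\<^sup>2 / 2 - f x" for x
  obtain C where C: "\<And>x. norm (f x) \<le> norm x * C"
    using f.bounded by blast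
  have lower: "- (C\<^sup>2 / 2) \<le> g x" for x
  proof -
    have "f x \<le> norm x * C" using C[of x] by simp
    moreover have "0 \<le> (norm x - C)\<^sup>2 / 2" by simp
    ultimately show ?thesis by (simp add: g_def power2_diff field_simps)
  qed
  define m where "m = (INF x. g x)"
  have bdd: "bdd_below (range g)" using lower by (auto simp: bdd_below_def)
  have m_le: "m \<le> g x" for x
    unfolding m_def by (rule cINF_lower[OF bdd]) simp
  have "\<exists>x. g x < m + 1 / Suc k" for k :: nat
    using cINF_less_iff[OF _ bdd, of "m + 1 / Suc k"] by (auto simp: m_def)
  then obtain X where X: "\<And>k. g (X k) < m + 1 / Suc k" by metis
  have par: "(norm (x - y))\<^sup>2 / 4 = g x + g y - 2 * g ((1/2) *\<^sub>R (x + y))" for x y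
    by (simp add: g_def f.scaleR f.add power2_norm_eq_inner inner_simps field_simps inner_commute)
  \<comment> \<open>The two values of \<open>g\<close> exceed the infimum by at most \<open>1 / Suc N\<close> each, and \<open>par\<close> has the factor \<open>1 / 4\<close>.\<close>
  have close: "(norm (X j - X k))\<^sup>2 \<le> 8 / Suc N" if "j \<ge> N" "k \<ge> N" for j k N
  proof -
    have *: "1 / Suc i \<le> 1 / Suc N" if "i \<ge> N" for i
      using that by (intro divide_left_mono) auto
    show ?thesis
      using par[of "X j" "X k"] X[of j] X[of k] m_le[of "(1/2) *\<^sub>R (X j + X k)"]
        *[OF that(1)] *[OF that(2)] by simp
  qed
  have "Cauchy X"
  proof (rule metric_CauchyI)
    fix e :: real assume "e > 0"
    then obtain N where N: "8 / e\<^sup>2 < real N" using reals_Archimedean2 by blast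
    have "dist (X j) (X k) < e" if "j \<ge> N" "k \<ge> N" for j k
    proof -
      have "8 / real (Suc N) < e\<^sup>2" using N \<open>e > 0\<close> by (simp add: field_simps add_strict_increasing)
      with close[OF that] have "(norm (X j - X k))\<^sup>2 < e\<^sup>2" by linarith
      then show ?thesis using \<open>e > 0\<close> by (simp add: dist_norm power2_less_imp_less)
    qed
    then show "\<exists>M. \<forall>j\<ge>M. \<forall>k\<ge>M. dist (X j) (X k) < e" by blast
  qed
  then obtain z where z: "X \<longlonglongrightarrow> z" using Cauchy_convergent convergent_def by blast
  have "(\<lambda>k. g (X k)) \<longlonglongrightarrow> g z"
    unfolding g_def by (intro tendsto_intros f.tendsto z) simp
  moreover have "(\<lambda>k. m + 1 / Suc k) \<longlonglongrightarrow> m + 0"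
    by (intro tendsto_intros LIMSEQ_Suc[OF lim_1_over_n])
  ultimately have "g z \<le> m + 0"
    by (rule LIMSEQ_le) (use X less_imp_le in blast)
  then have min: "g z \<le> g x" for x using m_le[of x] by simp
  have "f x = inner x z" for x
  proof (rule ccontr)
    define d where "d = inner x z - f x"
    assume "f x \<noteq> inner x z"
    then have "d \<noteq> 0" by (simp add: d_def)
    have exp: "g (z + t *\<^sub>R x) = g z + t * d + t\<^sup>2 * (norm x)\<^sup>2 / 2" for t
      unfolding g_def d_def power2_norm_eq_inner
      by (simp add: f.scaleR f.add inner_simps field_simps inner_commute power2_eq_square)
    \<comment> \<open>\<open>t = - d / \<parallel>x\<parallel>\<^sup>2\<close> minimises this quadratic; the summand \<open>1\<close> avoids division by zero.\<close>
    define s where "s = (norm x)\<^sup>2 + 1"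
    have "s > 0" by (simp add: s_def add_nonneg_pos)
    have "g (z + (- (d / s)) *\<^sub>R x) = g z - d\<^sup>2 / s + d\<^sup>2 / s * ((norm x)\<^sup>2 / s / 2)"
      unfolding exp by (simp add: power2_eq_square)
    with min[of "z + (- (d / s)) *\<^sub>R x"]
    have "d\<^sup>2 / s * (1 - (norm x)\<^sup>2 / s / 2) \<le> 0" by (simp add: algebra_simps)
    moreover have "d\<^sup>2 / s > 0" using \<open>d \<noteq> 0\<close> \<open>s > 0\<close> by simp
    moreover have le: "(norm x)\<^sup>2 / s \<le> 1"
      using \<open>s > 0\<close> by (subst divide_le_eq_1_pos) (simp_all add: s_def)
    moreover have "1 - u / 2 > 0" if "u \<le> 1" for u :: real using that by simp
    note this[OF le]
    ultimately show False using mult_pos_pos by (metis not_less)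
  qed
  then show ?thesis by blast
qed

lemma adjoint_exists:
  fixes a :: "'a::complex_hilbert \<Rightarrow>\<^sub>L 'b::complex_hilbert"
  assumes "a \<in> bop"
  shows "\<exists>b. \<forall>x y. cinner (blinfun_apply a x) y = cinner x (blinfun_apply b y)"
proof -
  have "\<exists>z. \<forall>x. inner (blinfun_apply a x) y = inner x z" for y
    by (rule Riesz_representation)
       (intro bounded_linear_compose[OF bounded_linear_inner_left] blinfun.bounded_linear_right)
  then obtain b where b: "\<And>x y. inner (blinfun_apply a x) y = inner x (b y)" by metis
  have eqI: "u = v" if "\<And>x. inner x u = inner x v" for u v :: 'a
    using that by (metis inner_diff_right inner_eq_zero_iff right_minus_eq)
  have "bounded_linear b"
  proof (rule bounded_linear_intro[where K = "norm a"])
    show "b (x + y) = b x + b y" for x y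
      by (rule eqI) (simp add: b[symmetric] inner_add_right)
    show "b (r *\<^sub>R x) = r *\<^sub>R b x" for r x
      by (rule eqI) (simp add: b[symmetric])
    show "norm (b y) \<le> norm y * norm a" for y
    proof (cases "b y = 0")
      case False
      have "norm (b y) * norm (b y) = inner (blinfun_apply a (b y)) y"
        by (simp add: b power2_norm_eq_inner[symmetric] power2_eq_square)
      also have "\<dots> \<le> norm (blinfun_apply a (b y)) * norm y"
        by (rule norm_cauchy_schwarz)
      also have "\<dots> \<le> (norm a * norm (b y)) * norm y"
        by (intro mult_right_mono norm_blinfun) auto
      finally have "norm (b y) * norm (b y) \<le> norm (b y) * (norm y * norm a)"
        by (simp add: ac_simps)
      then show ?thesis using False by simp
    qed simp
  qed
  then have "blinfun_apply (Blinfun b) = b" by (rule bounded_linear_Blinfun_apply)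
  moreover have "cinner (blinfun_apply a x) y = cinner x (b y)" for x y
    by (rule cinner_eqI_inner) (use b assms in \<open>auto simp: bop_def\<close>)
  ultimately show ?thesis by metis
qed

text \<open>
  The defining property characterises the adjoint for every \<open>a\<close>, whereas existence needs \<open>a\<close> to be
  complex linear; hence membership in \<open>bop\<close> is assumed throughout the rules that follow.
\<close>

lemma adj_eqI:
  assumes "\<And>x y. cinner (blinfun_apply a x) y = cinner x (blinfun_apply b y)"
  shows "adj a = b"
  unfolding adj_def
proof (rule the_equality)
  fix b' assume "\<forall>x y. cinner (blinfun_apply a x) y = cinner x (blinfun_apply b' y)"
  then show "b' = b"
    by - (rule blinfun_eqI, rule cinner_ext, metis assms)
qed (use assms in blast)

lemma cinner_adj:
  assumes "a \<in> bop"
  shows "cinner (blinfun_apply a x) y = cinner x (blinfun_apply (adj a) y)"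
  using adjoint_exists[OF assms] adj_eqI by metis

lemma cinner_adj_left:
  assumes "a \<in> bop"
  shows "cinner (blinfun_apply (adj a) x) y = cinner x (blinfun_apply a y)"
  by (metis assms cinner_adj cinner_commute)

lemma adj_bop [simp]: "a \<in> bop \<Longrightarrow> adj a \<in> bop"
  by (rule bopI, rule cinner_ext) (simp add: cinner_adj[symmetric] cinner_scaleC_right)

lemma adj_adj [simp]: "a \<in> bop \<Longrightarrow> adj (adj a) = a"
  by (rule adj_eqI) (simp add: cinner_adj_left)

lemma adj_id [simp]: "adj id_blinfun = id_blinfun"
  by (rule adj_eqI) simp

lemma adj_compose: "a \<in> bop \<Longrightarrow> b \<in> bop \<Longrightarrow> adj (a o\<^sub>L b) = adj b o\<^sub>L adj a"
  by (rule adj_eqI) (simp add: cinner_adj)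

lemma adj_add: "a \<in> bop \<Longrightarrow> b \<in> bop \<Longrightarrow> adj (a + b) = adj a + adj b"
  by (rule adj_eqI) (simp add: cinner_adj blinfun.bilinear_simps cinner_add_left cinner_add_right)

lemma adj_scaleC: "a \<in> bop \<Longrightarrow> adj (c *\<^sub>C a) = cnj c *\<^sub>C adj a"
  by (rule adj_eqI) (simp add: cinner_adj cinner_scaleC_left cinner_scaleC_right)

lemma adj_scaleR: "a \<in> bop \<Longrightarrow> adj (r *\<^sub>R a) = r *\<^sub>R adj a"
  by (simp add: scaleR_blinfun_scaleC adj_scaleC)

lemma adj_minus: "a \<in> bop \<Longrightarrow> adj (- a) = - adj a"
  using adj_scaleR[of a "-1"] by simp

lemma adj_diff: "a \<in> bop \<Longrightarrow> b \<in> bop \<Longrightarrow> adj (a - b) = adj a - adj b"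
  by (simp only: diff_conv_add_uminus adj_add adj_minus bop_minus)

lemma norm_adj_le: 
  assumes "a \<in> bop"
  shows "norm (adj a) \<le> norm a"
proof (rule norm_blinfun_bound)
  fix y
  show "norm (blinfun_apply (adj a) y) \<le> norm a * norm y"
  proof (cases "blinfun_apply (adj a) y = 0")
    case False
    let ?b = "blinfun_apply (adj a) y"
    have "norm ?b * norm ?b = inner (blinfun_apply a ?b) y"
      using cinner_adj[OF assms, of ?b y] 
      by (simp add: inner_eq_Re_cinner cinner_self power2_eq_square)
    also have "\<dots> \<le> norm (blinfun_apply a ?b) * norm y"
      by (rule norm_cauchy_schwarz)
    also have "\<dots> \<le> (norm a * norm ?b) * norm y"
      by (intro mult_right_mono norm_blinfun) auto
    finally have "norm ?b * norm ?b \<le> norm ?b * (norm a * norm y)"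
      by (simp add: ac_simps)
    then show ?thesis using False by simp
  qed simp
qed simp

lemma tendsto_adj:
  assumes "X \<longlonglongrightarrow> a" "\<And>k. X k \<in> bop" "a \<in> bop"
  shows "(\<lambda>k. adj (X k)) \<longlonglongrightarrow> adj a"
proof (rule metric_LIMSEQ_I)
  fix e :: real assume "e > 0"
  then obtain N where N: "\<And>k. k \<ge> N \<Longrightarrow> dist (X k) a < e"
    using assms(1) metric_LIMSEQ_D by blast
  have "dist (adj (X k)) (adj a) < e" if "k \<ge> N" for k
    using norm_adj_le[OF bop_diff[OF assms(2)[of k] assms(3)]] N[OF that]
    by (simp add: dist_norm adj_diff assms)
  then show "\<exists>N. \<forall>k\<ge>N. dist (adj (X k)) (adj a) < e" by blast
qed

lemma tendsto_compose [tendsto_intros]: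
  "(f \<longlongrightarrow> a) F \<Longrightarrow> (g \<longlongrightarrow> b) F \<Longrightarrow> ((\<lambda>k. f k o\<^sub>L g k) \<longlongrightarrow> a o\<^sub>L b) F"
  by (rule bounded_bilinear.tendsto[OF bounded_bilinear_blinfun_compose])

lemma tendsto_scaleC_blinfun [tendsto_intros]:
  fixes a :: "'a::complex_hilbert \<Rightarrow>\<^sub>L 'b::complex_hilbert"
  assumes "(f \<longlongrightarrow> a) F"
  shows "((\<lambda>k. c *\<^sub>C f k) \<longlongrightarrow> c *\<^sub>C a) F"
proof -
  have "bounded_linear (\<lambda>a::'a \<Rightarrow>\<^sub>L 'b. c *\<^sub>C a)"
  proof (rule bounded_linear_intro[where K = "cmod c"])
    fix a :: "'a \<Rightarrow>\<^sub>L 'b"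
    show "norm (c *\<^sub>C a) \<le> norm a * cmod c"
    proof (rule norm_blinfun_bound)
      fix x
      have "cmod c * norm (blinfun_apply a x) \<le> cmod c * (norm a * norm x)"
        by (intro mult_left_mono norm_blinfun) auto
      then show "norm (blinfun_apply (c *\<^sub>C a) x) \<le> norm a * cmod c * norm x"
        by (simp add: norm_scaleC mult_ac)
    qed simp
  qed (auto intro!: blinfun_eqI simp: blinfun.bilinear_simps scaleC_add_right scaleR_scaleC
        scaleC_left_commute)
  then show ?thesis using assms by (rule bounded_linear.tendsto)
qed

lemma blinfun_compose_distribs:
  fixes a b :: "'b::real_normed_vector \<Rightarrow>\<^sub>L 'c::real_normed_vector"
    and c d :: "'a::real_normed_vector \<Rightarrow>\<^sub>L 'b"
  shows "(a + b) o\<^sub>L c = (a o\<^sub>L c) + (b o\<^sub>L c)" "a o\<^sub>L (c + d) = (a o\<^sub>L c) + (a o\<^sub>L d)"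
    "(a - b) o\<^sub>L c = (a o\<^sub>L c) - (b o\<^sub>L c)" "a o\<^sub>L (c - d) = (a o\<^sub>L c) - (a o\<^sub>L d)"
    "(r *\<^sub>R a) o\<^sub>L c = r *\<^sub>R (a o\<^sub>L c)" "a o\<^sub>L (r *\<^sub>R c) = r *\<^sub>R (a o\<^sub>L c)"
    "a o\<^sub>L (- c) = - (a o\<^sub>L c)" "(- a) o\<^sub>L c = - (a o\<^sub>L c)"
  by (rule blinfun_eqI; simp add: blinfun.bilinear_simps)+

lemma compose_id [simp]: "a o\<^sub>L id_blinfun = a" "id_blinfun o\<^sub>L a = a"
  by (rule blinfun_eqI; simp)+

lemma compose_assoc: "(a o\<^sub>L b) o\<^sub>L c = a o\<^sub>L (b o\<^sub>L c)"
  by (rule blinfun_eqI) simp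

lemma compose_scaleC:
  "(c *\<^sub>C a) o\<^sub>L b = c *\<^sub>C (a o\<^sub>L b)" 
  "d \<in> bop \<Longrightarrow> d o\<^sub>L (c *\<^sub>C e) = c *\<^sub>C (d o\<^sub>L e)"
  by (rule blinfun_eqI; simp add: bopD)+

section \<open>Isometries, unitaries and compressions\<close>

lemma isometry_bop: "isometry_op V \<Longrightarrow> V \<in> bop"
  by (simp add: isometry_op_def)

lemma adj_isometry: "isometry_op V \<Longrightarrow> adj V o\<^sub>L V = id_blinfun"
  by (rule blinfun_eqI, rule cinner_ext) (simp add: isometry_op_def cinner_adj[symmetric])

text \<open>
  The projection onto the range of an isometry \<open>V\<close> is \<open>V V\<^sup>*\<close>, so the compression along \<open>V\<close> is
  the algebraic expression \<open>V\<^sup>* a V\<close>.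
\<close>

lemma compression_eq:
  assumes "isometry_op V"
  shows "compression V a = adj V o\<^sub>L a o\<^sub>L V"
proof -
  have V: "V \<in> bop" and VV: "blinfun_apply (adj V) (blinfun_apply V h) = h" for h
    using isometry_bop[OF assms] arg_cong[OF adj_isometry[OF assms], of "\<lambda>a. blinfun_apply a h"]
    by auto
  have diff: "cinner (x - y) z = cinner x z - cinner y z" for x y z :: 'b
    using cinner_add_left[of "x - y" y z] by simp
  have "orth_proj (range (blinfun_apply V)) x = blinfun_apply V (blinfun_apply (adj V) x)" for x
    unfolding orth_proj_def
  proof (rule the_equality)
    fix y assume y: "y \<in> range (blinfun_apply V) \<and>
      (\<forall>z\<in>range (blinfun_apply V). cinner (x - y) z = 0)"
    then obtain h where h: "y = blinfun_apply V h" by blast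
    have "cinner (blinfun_apply (adj V) (x - y)) k = 0" for k
      using y by (simp add: cinner_adj_left V)
    then have "blinfun_apply (adj V) (x - y) = 0"
      by (metis cinner_self norm_eq_zero of_real_eq_0_iff zero_eq_power2)
    then have "blinfun_apply (adj V) x = h" by (simp add: blinfun.bilinear_simps h VV)
    then show "y = blinfun_apply V (blinfun_apply (adj V) x)" by (simp add: h)
  qed (auto simp: diff cinner_adj_left[symmetric] V VV)
  moreover have "inj (blinfun_apply V)" by (metis VV injI)
  moreover have "(\<lambda>h. blinfun_apply (adj V) (blinfun_apply a (blinfun_apply V h))) =
      blinfun_apply (adj V o\<^sub>L a o\<^sub>L V)"
    by (rule ext) simp
  ultimately have "compression V a = Blinfun (blinfun_apply (adj V o\<^sub>L a o\<^sub>L V))"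
    unfolding compression_def by simp
  then show ?thesis by (simp add: blinfun_apply_inverse)
qed

lemma unitary_bop: "unitary_op U \<Longrightarrow> U \<in> bop"
  and unitary_adj_left: "unitary_op U \<Longrightarrow> adj U o\<^sub>L U = id_blinfun"
  and unitary_adj_right: "unitary_op U \<Longrightarrow> U o\<^sub>L adj U = id_blinfun"
  by (auto simp: unitary_op_def)

lemma op_inverse_unitary:
  assumes "unitary_op U"
  shows "op_inverse U = adj U"
  unfolding op_inverse_def
proof (rule the_equality)
  fix b assume b: "b o\<^sub>L U = id_blinfun \<and> U o\<^sub>L b = id_blinfun"
  have "b = (b o\<^sub>L U) o\<^sub>L adj U"
    by (simp add: compose_assoc unitary_adj_right[OF assms])
  with b show "b = adj U" by simp
qed (use assms in \<open>auto simp: unitary_op_def\<close>)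

lemma op_power_Suc_right: "op_power a (Suc m) = op_power a m o\<^sub>L a"
  by (induction m) (simp, metis compose_assoc op_power.simps(2))

text \<open>
  For a unitary the two kinds of powers in the dilation equation agree.  \<open>star_power\<close> is the more
  convenient one, because its negative powers avoid the definite description in \<open>op_inverse\<close>.
\<close>

lemma op_zpower_unitary: "unitary_op U \<Longrightarrow> op_zpower U k = star_power U k"
  by (simp add: op_zpower_def star_power_def op_inverse_unitary)

lemma star_power_0 [simp]: "star_power U 0 = id_blinfun"
  by (simp add: star_power_def)

lemma star_power_1 [simp]: "star_power U 1 = U"
  by (simp add: star_power_def)

lemma star_power_minus_1 [simp]: "star_power U (-1) = adj U"
  by (simp add: star_power_def)

lemma star_power_unitary_Suc:
  assumes "unitary_op U"
  shows "star_power U (k + 1) = U o\<^sub>L star_power U k"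
proof (cases "k \<ge> 0")
  case True
  then show ?thesis by (simp add: star_power_def nat_add_distrib)
next
  case False
  then have "nat (- k) = Suc (nat (- (k + 1)))" by simp
  then have "star_power U k = adj U o\<^sub>L op_power (adj U) (nat (- (k + 1)))"
    using False by (simp only: star_power_def op_power.simps if_False)
  then have "U o\<^sub>L star_power U k = op_power (adj U) (nat (- (k + 1)))"
    by (simp add: compose_assoc[symmetric] unitary_adj_right[OF assms])
  then show ?thesis using False by (cases "k = -1") (auto simp: star_power_def)
qed

lemma star_power_unitary_pred:
  assumes "unitary_op U"
  shows "star_power U (k - 1) = adj U o\<^sub>L star_power U k"
  using star_power_unitary_Suc[OF assms, of "k - 1"]
  by (simp add: compose_assoc[symmetric] unitary_adj_left[OF assms])

lemma star_power_unitary_add: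
  assumes "unitary_op U"
  shows "star_power U (k + l) = star_power U k o\<^sub>L star_power U l"
proof (induction k rule: int_induct[where k = 0])
  case (step1 i)
  then show ?case
    using star_power_unitary_Suc[OF assms, of "i + l"] star_power_unitary_Suc[OF assms, of i]
    by (simp add: compose_assoc algebra_simps)
next
  case (step2 i)
  then show ?case
    using star_power_unitary_pred[OF assms, of "i + l"] star_power_unitary_pred[OF assms, of i]
    by (simp add: compose_assoc algebra_simps)
qed simp

lemma op_power_bop: "a \<in> bop \<Longrightarrow> op_power a m \<in> bop"
  by (induction m) (simp_all add: bop_compose)

lemma star_power_bop: "a \<in> bop \<Longrightarrow> star_power a k \<in> bop"
  by (simp add: star_power_def op_power_bop)

lemma adj_op_power: "a \<in> bop \<Longrightarrow> adj (op_power a m) = op_power (adj a) m"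
proof (induction m)
  case (Suc m)
  then show ?case
    using op_power_Suc_right[of "adj a" m] by (simp add: adj_compose op_power_bop)
qed simp

lemma adj_star_power: "a \<in> bop \<Longrightarrow> adj (star_power a k) = star_power a (- k)"
  by (cases "k = 0") (auto simp: star_power_def adj_op_power)

section \<open>The defect operator\<close>

text \<open>
  The square root of \<open>1 - A\<close> below is a limit in operator norm, so the operators on a complex Hilbert
  space must be known to form a complete space.
\<close>

instance complex_hilbert \<subseteq> banach ..

lemma dist_le_dominated_increments:
  fixes X :: "nat \<Rightarrow> 'a::real_normed_vector" and y :: "nat \<Rightarrow> real"
  assumes "\<And>k. norm (X (Suc k) - X k) \<le> y (Suc k) - y k"
  shows "norm (X (m + k) - X m) \<le> y (m + k) - y m"
proof (induction k)
  case (Suc k)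
  have "norm (X (m + Suc k) - X m) \<le> norm (X (Suc (m + k)) - X (m + k)) + norm (X (m + k) - X m)"
    using norm_triangle_ineq[of "X (Suc (m + k)) - X (m + k)" "X (m + k) - X m"] by simp
  also have "\<dots> \<le> y (m + Suc k) - y m"
    using Suc assms[of "m + k"] by simp
  finally show ?case .
qed simp

lemma Cauchy_dominated_increments:
  fixes X :: "nat \<Rightarrow> 'a::real_normed_vector" and y :: "nat \<Rightarrow> real"
  assumes "\<And>k. norm (X (Suc k) - X k) \<le> y (Suc k) - y k" "Cauchy y"
  shows "Cauchy X"
proof (rule metric_CauchyI)
  fix e :: real assume "e > 0"
  then obtain N where N: "\<And>m n. m \<ge> N \<Longrightarrow> n \<ge> N \<Longrightarrow> dist (y m) (y n) < e / 2"
    using metric_CauchyD[OF assms(2), of "e / 2"] by auto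
  have *: "dist (X m) (X N) < e / 2" if "m \<ge> N" for m
    using dist_le_dominated_increments[of X y N "m - N", OF assms(1)] N[OF that order_refl] that
      abs_ge_self[of "y m - y N"]
    by (simp add: dist_norm)
  have "dist (X m) (X n) < e" if "m \<ge> N" "n \<ge> N" for m n
    using *[OF that(1)] *[OF that(2)] by (rule dist_triangle_half_l)
  then show "\<exists>M. \<forall>m\<ge>M. \<forall>n\<ge>M. dist (X m) (X n) < e" by blast
qed

text \<open>
  A solution of the fixed-point equation \<open>Y = (A + Y\<^sup>2) / 2\<close> satisfies \<open>(1 - Y)\<^sup>2 = 1 - A\<close>.  Iterating
  from \<open>0\<close> stays inside every closed algebra that contains \<open>A\<close>, and inherits self-adjointness and
  intertwining relations from \<open>A\<close>.
\<close>

primrec sqrt_iter :: "('a::real_normed_vector \<Rightarrow>\<^sub>L 'a) \<Rightarrow> nat \<Rightarrow> 'a \<Rightarrow>\<^sub>L 'a" where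
  "sqrt_iter A 0 = 0"
| "sqrt_iter A (Suc k) = (1 / 2) *\<^sub>R (A + (sqrt_iter A k o\<^sub>L sqrt_iter A k))"

text \<open>For self-adjoint \<open>A\<close> of norm at most \<open>1\<close> this is the positive square root of \<open>1 - A\<close>.\<close>

definition sqrt_compl :: "('a::real_normed_vector \<Rightarrow>\<^sub>L 'a) \<Rightarrow> 'a \<Rightarrow>\<^sub>L 'a" where
  "sqrt_compl A = id_blinfun - lim (sqrt_iter A)"

text \<open>The same iteration for real numbers at \<open>A = 1\<close>.\<close>

primrec scalar_sqrt_iter :: "nat \<Rightarrow> real" where
  "scalar_sqrt_iter 0 = 0"
| "scalar_sqrt_iter (Suc k) = (1 + (scalar_sqrt_iter k)\<^sup>2) / 2"

lemma scalar_sqrt_iter_bounds: "0 \<le> scalar_sqrt_iter k \<and> scalar_sqrt_iter k \<le> 1"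
  by (induction k) (auto simp: power_le_one)

lemma Cauchy_scalar_sqrt_iter: "Cauchy scalar_sqrt_iter"
proof -
  have "incseq scalar_sqrt_iter"
  proof (rule incseq_SucI)
    show "scalar_sqrt_iter k \<le> scalar_sqrt_iter (Suc k)" for k
      using zero_le_power2[of "scalar_sqrt_iter k - 1"] by (simp add: power2_diff)
  qed
  then show ?thesis
    using scalar_sqrt_iter_bounds incseq_convergent[of scalar_sqrt_iter 1]
    by (metis convergent_Cauchy convergent_def)
qed

lemma sqrt_iter_intertwine:
  assumes "S o\<^sub>L A = B o\<^sub>L S"
  shows "S o\<^sub>L sqrt_iter A k = sqrt_iter B k o\<^sub>L S"
proof (induction k)
  case (Suc k)
  have "S o\<^sub>L (sqrt_iter A k o\<^sub>L sqrt_iter A k) = (sqrt_iter B k o\<^sub>L sqrt_iter B k) o\<^sub>L S"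
    by (metis Suc compose_assoc)
  then show ?case by (simp add: blinfun_compose_distribs assms)
qed simp

text \<open>
  The iterates are polynomials in \<open>A\<close> with nonnegative coefficients, and so are their increments.
  Hence for \<open>\<parallel>A\<parallel> \<le> 1\<close> the norms are dominated by the values at \<open>A = 1\<close>, which form a bounded
  increasing sequence of reals.  The factorisation of the increments below expresses this without
  mentioning polynomials.
\<close>

lemma sqrt_iter_tendsto:
  fixes A :: "'a::complex_hilbert \<Rightarrow>\<^sub>L 'a"
  assumes "norm A \<le> 1"
  shows "sqrt_iter A \<longlonglongrightarrow> id_blinfun - sqrt_compl A"
proof -
  let ?Y = "sqrt_iter A" and ?y = scalar_sqrt_iter
  have bound: "norm (?Y k) \<le> ?y k" for k
  proof (induction k)
    case (Suc k)
    have "norm (?Y k o\<^sub>L ?Y k) \<le> (?y k)\<^sup>2"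
      using norm_blinfun_compose[of "?Y k" "?Y k"] mult_mono[OF Suc Suc] scalar_sqrt_iter_bounds[of k]
      by (simp add: power2_eq_square)
    then show ?case
      using norm_triangle_ineq[of A "?Y k o\<^sub>L ?Y k"] assms by simp
  qed simp
  have commA: "A o\<^sub>L ?Y k = ?Y k o\<^sub>L A" for k
    by (rule sqrt_iter_intertwine) simp
  have comm: "?Y j o\<^sub>L ?Y k = ?Y k o\<^sub>L ?Y j" for j k
    by (rule sqrt_iter_intertwine) (simp add: commA)
  have "norm (?Y (Suc k) - ?Y k) \<le> ?y (Suc k) - ?y k" for k
  proof (induction k)
    case 0
    then show ?case using assms by simp
  next
    case (Suc k)
    let ?D = "?Y (Suc k) - ?Y k" and ?S = "?Y (Suc k) + ?Y k"
    \<comment> \<open>A difference of squares, since the iterates commute.\<close>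
    have D: "?Y (Suc (Suc k)) - ?Y (Suc k) = (1 / 2) *\<^sub>R (?D o\<^sub>L ?S)"
      unfolding sqrt_iter.simps(2)[of A "Suc k"]
      by (subst (3) sqrt_iter.simps(2))
         (simp add: blinfun_compose_distribs comm[of "Suc k" k] scaleR_diff_right
           scaleR_add_right del: sqrt_iter.simps(2))
    have "norm (?D o\<^sub>L ?S) \<le> norm ?D * norm ?S" by (rule norm_blinfun_compose)
    also have "\<dots> \<le> (?y (Suc k) - ?y k) * (?y (Suc k) + ?y k)"
      using norm_triangle_ineq[of "?Y (Suc k)" "?Y k"] bound[of "Suc k"] bound[of k] Suc
        order_trans[OF norm_ge_zero Suc]
      by (intro mult_mono) (linarith | rule norm_ge_zero)+
    finally have "norm (?D o\<^sub>L ?S) \<le> (?y (Suc k))\<^sup>2 - (?y k)\<^sup>2"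
      by (simp add: algebra_simps power2_eq_square)
    then have "norm ((1 / 2) *\<^sub>R (?D o\<^sub>L ?S)) \<le> ((?y (Suc k))\<^sup>2 - (?y k)\<^sup>2) / 2"
      by simp
    also have "\<dots> = ?y (Suc (Suc k)) - ?y (Suc k)"
      by (simp add: field_simps)
    finally show ?case unfolding D .
  qed
  from Cauchy_dominated_increments[OF this Cauchy_scalar_sqrt_iter]
  have "?Y \<longlonglongrightarrow> lim ?Y" by (simp add: Cauchy_convergent_iff convergent_LIMSEQ_iff)
  then show ?thesis by (simp add: sqrt_compl_def)
qed

lemma sqrt_compl_tendsto:
  fixes A :: "'a::complex_hilbert \<Rightarrow>\<^sub>L 'a"
  assumes "norm A \<le> 1"
  shows "(\<lambda>k. id_blinfun - sqrt_iter A k) \<longlonglongrightarrow> sqrt_compl A"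
  using tendsto_diff[OF tendsto_const sqrt_iter_tendsto[OF assms], of id_blinfun] by simp

lemma sqrt_compl_square:
  fixes A :: "'a::complex_hilbert \<Rightarrow>\<^sub>L 'a"
  assumes "norm A \<le> 1"
  shows "sqrt_compl A o\<^sub>L sqrt_compl A = id_blinfun - A"
proof -
  define Y where "Y = id_blinfun - sqrt_compl A"
  have Y: "sqrt_iter A \<longlonglongrightarrow> Y" unfolding Y_def by (rule sqrt_iter_tendsto[OF assms])
  have "(\<lambda>k. sqrt_iter A (Suc k)) \<longlonglongrightarrow> (1 / 2) *\<^sub>R (A + (Y o\<^sub>L Y))"
    unfolding sqrt_iter.simps by (intro tendsto_intros Y)
  with LIMSEQ_Suc[OF Y] have "Y = (1 / 2) *\<^sub>R (A + (Y o\<^sub>L Y))"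
    by (rule LIMSEQ_unique)
  then have "2 *\<^sub>R Y = A + (Y o\<^sub>L Y)"
    by (metis divide_self_if scaleR_one scaleR_scaleR times_divide_eq_right mult.right_neutral
        zero_neq_numeral)
  then have "Y + Y - (Y o\<^sub>L Y) = A" by (simp add: scaleR_2)
  moreover have "sqrt_compl A = id_blinfun - Y" by (simp add: Y_def)
  moreover have "(id_blinfun - Y) o\<^sub>L (id_blinfun - Y) = id_blinfun - (Y + Y - (Y o\<^sub>L Y))"
    by (simp add: blinfun_compose_distribs algebra_simps)
  ultimately show ?thesis by simp
qed

lemma sqrt_compl_intertwine:
  fixes A :: "'a::complex_hilbert \<Rightarrow>\<^sub>L 'a" and B :: "'b::complex_hilbert \<Rightarrow>\<^sub>L 'b"
  assumes "norm A \<le> 1" "norm B \<le> 1" "S o\<^sub>L A = B o\<^sub>L S"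
  shows "S o\<^sub>L sqrt_compl A = sqrt_compl B o\<^sub>L S"
proof (rule LIMSEQ_unique)
  show "(\<lambda>k. (S o\<^sub>L (id_blinfun - sqrt_iter A k))) \<longlonglongrightarrow> (S o\<^sub>L sqrt_compl A)"
    by (intro tendsto_intros sqrt_compl_tendsto assms)
  have "(\<lambda>k. (id_blinfun - sqrt_iter B k) o\<^sub>L S) \<longlonglongrightarrow> (sqrt_compl B o\<^sub>L S)"
    by (intro tendsto_intros sqrt_compl_tendsto assms)
  then show "(\<lambda>k. (S o\<^sub>L (id_blinfun - sqrt_iter A k))) \<longlonglongrightarrow> (sqrt_compl B o\<^sub>L S)"
    by (simp add: blinfun_compose_distribs sqrt_iter_intertwine[OF assms(3)])
qed

section \<open>C*-algebras generated by one operator\<close>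

lemma unital_cstar_algebra_bop:
  "unital_cstar_algebra (bop :: ('a::complex_hilbert \<Rightarrow>\<^sub>L 'a) set)"
  by (simp add: unital_cstar_algebra_def bop_add bop_compose bop_scaleC closed_bop)

lemma unital_cstar_algebra_generated:
  assumes "T \<in> bop"
  shows "unital_cstar_algebra (cstar_generated T)"
proof -
  have "cstar_generated T \<subseteq> bop"
    unfolding cstar_generated_def using assms
    by (intro hull_minimal unital_cstar_algebra_bop) simp
  moreover have "closed (cstar_generated T)"
    unfolding cstar_generated_def hull_def
    by (rule closed_Inter) (auto simp: unital_cstar_algebra_def)
  moreover have "id_blinfun \<in> cstar_generated T"
    by (auto simp: cstar_generated_def hull_def unital_cstar_algebra_def)
  moreover have "a + b \<in> cstar_generated T" "a o\<^sub>L b \<in> cstar_generated T"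
    "adj a \<in> cstar_generated T" "c *\<^sub>C a \<in> cstar_generated T"
    if "a \<in> cstar_generated T" "b \<in> cstar_generated T" for a b c
    using that by (auto simp: cstar_generated_def hull_def unital_cstar_algebra_def)
  ultimately show ?thesis by (simp add: unital_cstar_algebra_def)
qed

lemma cstar_generated_self: "T \<in> cstar_generated T"
  unfolding cstar_generated_def by (simp add: hull_inc)

lemma cstar_generated_minimal:
  "T \<in> A \<Longrightarrow> unital_cstar_algebra A \<Longrightarrow> cstar_generated T \<subseteq> A"
  unfolding cstar_generated_def by (rule hull_minimal) auto

context
  fixes A :: "('a::complex_hilbert \<Rightarrow>\<^sub>L 'a) set"
  assumes A: "unital_cstar_algebra A"
begin

lemma cstar_bop: "a \<in> A \<Longrightarrow> a \<in> bop"
  and cstar_id: "id_blinfun \<in> A"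
  and cstar_add: "a \<in> A \<Longrightarrow> b \<in> A \<Longrightarrow> a + b \<in> A"
  and cstar_compose: "a \<in> A \<Longrightarrow> b \<in> A \<Longrightarrow> a o\<^sub>L b \<in> A"
  and cstar_adj: "a \<in> A \<Longrightarrow> adj a \<in> A"
  and cstar_scaleC: "a \<in> A \<Longrightarrow> c *\<^sub>C a \<in> A"
  and cstar_closed: "closed A"
  using A by (auto simp: unital_cstar_algebra_def)

lemma cstar_scaleR: "a \<in> A \<Longrightarrow> r *\<^sub>R a \<in> A"
  by (simp add: scaleR_blinfun_scaleC cstar_scaleC)

lemma cstar_diff: "a \<in> A \<Longrightarrow> b \<in> A \<Longrightarrow> a - b \<in> A"
  using cstar_add[of a "(-1) *\<^sub>R b"] cstar_scaleR[of b "-1"] by simp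

lemma cstar_zero: "0 \<in> A"
  using cstar_diff[OF cstar_id cstar_id] by simp

lemma cstar_star_power:
  assumes "a \<in> A"
  shows "star_power a k \<in> A"
proof -
  have "b \<in> A \<Longrightarrow> op_power b m \<in> A" for b m
    by (induction m) (auto intro: cstar_id cstar_compose)
  then show ?thesis
    using assms by (simp add: star_power_def cstar_adj)
qed

lemma cstar_sqrt_compl:
  assumes "a \<in> A" "norm a \<le> 1"
  shows "sqrt_compl a \<in> A"
proof (rule closed_sequentially[OF cstar_closed])
  have "sqrt_iter a k \<in> A" for k
    by (induction k) (auto intro!: cstar_zero cstar_scaleR cstar_add cstar_compose assms)
  then show "id_blinfun - sqrt_iter a k \<in> A" for k
    by (intro cstar_diff cstar_id)
qed (rule sqrt_compl_tendsto[OF assms(2)])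

end

lemma sqrt_compl_bop: "a \<in> bop \<Longrightarrow> norm a \<le> 1 \<Longrightarrow> sqrt_compl a \<in> bop"
  by (rule cstar_sqrt_compl[OF unital_cstar_algebra_bop])

lemma sqrt_compl_selfadjoint:
  assumes "a \<in> bop" "norm a \<le> 1" "adj a = a"
  shows "adj (sqrt_compl a) = sqrt_compl a"
proof -
  have bop: "sqrt_iter a k \<in> bop" for k
    by (induction k) (auto intro!: bop_scaleR bop_add bop_compose assms)
  have "adj (sqrt_iter a k) = sqrt_iter a k" for k
  proof (induction k)
    case 0
    show ?case using adj_scaleR[of "0 :: 'a \<Rightarrow>\<^sub>L 'a" 0] by simp
  next
    case (Suc k)
    then show ?case
      by (simp add: adj_scaleR adj_add bop_add bop_compose adj_compose assms bop)
  qed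
  then have "adj (id_blinfun - sqrt_iter a k) = id_blinfun - sqrt_iter a k" for k
    by (simp add: adj_diff bop)
  moreover have "(\<lambda>k. adj (id_blinfun - sqrt_iter a k)) \<longlonglongrightarrow> adj (sqrt_compl a)"
    by (intro tendsto_adj sqrt_compl_tendsto sqrt_compl_bop bop_diff bop_id bop assms)
  ultimately show ?thesis
    using LIMSEQ_unique sqrt_compl_tendsto[OF assms(2)] by fastforce
qed

lemma norm_adj_compose_le:
  assumes "T \<in> bop" "norm T \<le> 1"
  shows "norm (adj T o\<^sub>L T) \<le> 1" "norm (T o\<^sub>L adj T) \<le> 1"
proof -
  have "norm (adj T) \<le> 1" using norm_adj_le[OF assms(1)] assms(2) by linarith
  then have "norm (adj T) * norm T \<le> 1"
    using assms(2) by (simp add: mult_le_one)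
  then show "norm (adj T o\<^sub>L T) \<le> 1" "norm (T o\<^sub>L adj T) \<le> 1"
    using norm_blinfun_compose[of "adj T" T] norm_blinfun_compose[of T "adj T"]
    by (simp_all add: mult.commute)
qed

text \<open>
  The defect operator \<open>(1 - T\<^sup>* T)\<^sup>1\<^sup>/\<^sup>2\<close>.  That it lies in the algebra generated by \<open>T\<close> is what makes
  the dilations in different coordinates commute.
\<close>

definition defect :: "('a::complex_hilbert \<Rightarrow>\<^sub>L 'a) \<Rightarrow> 'a \<Rightarrow>\<^sub>L 'a" where
  "defect T = sqrt_compl (adj T o\<^sub>L T)"

context
  fixes T :: "'a::complex_hilbert \<Rightarrow>\<^sub>L 'a"
  assumes T: "T \<in> bop" and T1: "norm T \<le> 1"
begin

lemma adj_contraction: "adj T \<in> bop" "norm (adj T) \<le> 1"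
  using norm_adj_le[OF T] T1 T by simp_all

lemma defect_square: "defect T o\<^sub>L defect T = id_blinfun - (adj T o\<^sub>L T)"
  unfolding defect_def by (rule sqrt_compl_square[OF norm_adj_compose_le(1)[OF T T1]])

lemma adj_defect: "adj (defect T) = defect T"
  unfolding defect_def
  by (rule sqrt_compl_selfadjoint)
     (simp_all add: bop_compose adj_compose T norm_adj_compose_le(1)[OF T T1])

lemma defect_generated: "defect T \<in> cstar_generated T"
  unfolding defect_def
  by (intro cstar_sqrt_compl cstar_compose cstar_adj unital_cstar_algebra_generated T
      cstar_generated_self norm_adj_compose_le T1)

lemma defect_adj_generated: "defect (adj T) \<in> cstar_generated T"
  unfolding defect_def using T
  by (intro cstar_sqrt_compl cstar_compose cstar_adj unital_cstar_algebra_generated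
      cstar_generated_self) (use norm_adj_compose_le[OF T T1] in simp_all)

text \<open>From \<open>T (T\<^sup>* T) = (T T\<^sup>*) T\<close>, which passes to the square roots.\<close>

lemma defect_intertwine: "T o\<^sub>L defect T = defect (adj T) o\<^sub>L T"
  unfolding defect_def using T
  by (intro sqrt_compl_intertwine) (use norm_adj_compose_le[OF T T1] in \<open>simp_all add: compose_assoc\<close>)

end

text \<open>
  For a contraction \<open>B\<close>, the operator \<open>1 - B\<^sup>* B\<close> is again a self-adjoint contraction, so the square
  root \<open>c\<close> of \<open>1 - (1 - B\<^sup>* B)\<close> is available.  The general case follows by scaling.
\<close>

lemma adj_compose_self_factor:
  fixes B :: "'a::complex_hilbert \<Rightarrow>\<^sub>L 'b::complex_hilbert"
  assumes "B \<in> bop"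
  shows "\<exists>c\<in>(bop :: ('a \<Rightarrow>\<^sub>L 'a) set). adj B o\<^sub>L B = adj c o\<^sub>L c"
proof -
  \<comment> \<open>The summand \<open>1\<close> allows for \<open>B = 0\<close>.\<close>
  define l where "l = norm B + 1"
  have l: "l > 0" by (simp add: l_def add_nonneg_pos)
  define C where "C = (1 / l) *\<^sub>R B"
  have C: "C \<in> bop" "norm C \<le> 1" and B: "B = l *\<^sub>R C"
    using l by (simp_all add: C_def bop_scaleR assms) (simp add: l_def)
  have C': "norm (adj C) \<le> 1" using norm_adj_le[OF C(1)] C(2) by linarith
  define A where "A = id_blinfun - (adj C o\<^sub>L C)"
  have A: "A \<in> bop" "adj A = A"
    unfolding A_def using C by (simp_all add: bop_diff bop_compose adj_diff adj_compose)
  have "norm A \<le> 1"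
  proof (rule norm_blinfun_bound)
    fix x
    let ?C = "blinfun_apply C x" and ?A = "blinfun_apply (adj C) (blinfun_apply C x)"
    have "inner x ?A = (norm ?C)\<^sup>2"
      by (metis C(1) Re_complex_of_real cinner_adj cinner_self inner_eq_Re_cinner)
    moreover have "norm ?A \<le> norm ?C"
      using norm_blinfun[of "adj C" ?C] mult_right_mono[OF C' norm_ge_zero[of ?C]] by simp
    then have "(norm ?A)\<^sup>2 \<le> (norm ?C)\<^sup>2" by (simp add: power_mono)
    moreover have "(norm (x - ?A))\<^sup>2 = (norm x)\<^sup>2 - 2 * inner x ?A + (norm ?A)\<^sup>2"
      by (simp add: power2_norm_eq_inner inner_simps inner_commute)
    ultimately have "(norm (x - ?A))\<^sup>2 \<le> (norm x)\<^sup>2"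
      using zero_le_power2[of "norm ?C"] by linarith
    then have "norm (x - ?A) \<le> norm x" by (rule power2_le_imp_le) simp
    then show "norm (blinfun_apply A x) \<le> 1 * norm x" by (simp add: A_def blinfun.bilinear_simps)
  qed simp
  define c where "c = l *\<^sub>R sqrt_compl A"
  have s: "sqrt_compl A \<in> bop" by (rule sqrt_compl_bop[OF A(1) \<open>norm A \<le> 1\<close>])
  have "adj c o\<^sub>L c = (l * l) *\<^sub>R (id_blinfun - A)"
    unfolding c_def using sqrt_compl_square[OF \<open>norm A \<le> 1\<close>]
      sqrt_compl_selfadjoint[OF A(1) \<open>norm A \<le> 1\<close> A(2)]
    by (simp add: adj_scaleR s blinfun_compose_distribs)
  also have "\<dots> = adj B o\<^sub>L B"
    by (simp add: A_def B adj_scaleR C blinfun_compose_distribs)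
  finally have "adj B o\<^sub>L B = adj c o\<^sub>L c" by simp
  moreover have "c \<in> bop" by (simp add: c_def bop_scaleR s)
  ultimately show ?thesis by blast
qed

section \<open>Operators on square-summable families\<close>

lemma ell2_eqI: "(\<And>x. ell2_apply f x = ell2_apply g x) \<Longrightarrow> f = g"
  by (metis ell2_apply_inject ext)

lemma adj_zero [simp]: "adj (0 :: 'a::complex_hilbert \<Rightarrow>\<^sub>L 'b::complex_hilbert) = 0"
  using adj_scaleR[OF bop_zero, of 0] by simp

lemmas ell2_apply_simps =
  zero_ell2.rep_eq plus_ell2.rep_eq minus_ell2.rep_eq uminus_ell2.rep_eq scaleR_ell2.rep_eq
  scaleC_ell2.rep_eq

text \<open>
  Boundedness on \<open>\<ell>\<^sup>2\<close> is checked on finite partial sums, which needs no separate argument for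
  summability.
\<close>

lemma ell2_finite_sums_bound:
  fixes g :: "'i \<Rightarrow> 'a::complex_inner"
  assumes B: "\<And>F. finite F \<Longrightarrow> (\<Sum>x\<in>F. (norm (g x))\<^sup>2) \<le> B\<^sup>2" and "0 \<le> B"
  shows "ell2_apply (Abs_ell2 g) = g" "norm (Abs_ell2 g) \<le> B"
proof -
  have s: "square_summable g"
    unfolding square_summable_def
    by (rule nonneg_bdd_above_summable_on) (use B in \<open>auto simp: bdd_above_def\<close>)
  then show g: "ell2_apply (Abs_ell2 g) = g" by (simp add: Abs_ell2_inverse)
  have "(norm (Abs_ell2 g))\<^sup>2 \<le> B\<^sup>2"
    unfolding norm_ell2_power2 g
    by (rule infsum_le_finite_sums) (use s B in \<open>auto simp: square_summable_def\<close>)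
  then show "norm (Abs_ell2 g) \<le> B" using \<open>0 \<le> B\<close> by (rule power2_le_imp_le)
qed

definition ell2_eval :: "'i \<Rightarrow> ('i, 'a::complex_hilbert) ell2 \<Rightarrow>\<^sub>L 'a" where
  "ell2_eval j = Blinfun (\<lambda>f. ell2_apply f j)"

lemma ell2_eval_apply [simp]:
  fixes f :: "('i, 'a::complex_hilbert) ell2"
  shows "blinfun_apply (ell2_eval j) f = ell2_apply f j"
proof -
  have "bounded_linear (\<lambda>f :: ('i, 'a) ell2. ell2_apply f j)"
    by (rule bounded_linear_intro[where K = 1])
       (simp_all add: ell2_apply_simps norm_ell2_apply_le)
  then show ?thesis by (simp add: ell2_eval_def bounded_linear_Blinfun_apply)
qed

definition ell2_single :: "'i \<Rightarrow> 'a::complex_hilbert \<Rightarrow>\<^sub>L ('i, 'a) ell2" where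
  "ell2_single j = Blinfun (\<lambda>h. Abs_ell2 (\<lambda>x. if x = j then h else 0))"

lemma ell2_single_apply [simp]:
  fixes h :: "'a::complex_hilbert"
  shows "ell2_apply (blinfun_apply (ell2_single j) h) x = (if x = j then h else 0)"
proof -
  let ?g = "\<lambda>h x. if x = j then h else 0 :: 'a"
  have "(\<Sum>x\<in>F. (norm (?g h x))\<^sup>2) \<le> (norm h)\<^sup>2" if "finite F" for F h
  proof -
    have "(\<Sum>x\<in>F. (norm (?g h x))\<^sup>2) = (\<Sum>x\<in>F. if x = j then (norm h)\<^sup>2 else 0)"
      by (rule sum.cong) auto
    then show ?thesis using that by simp
  qed
  note g = ell2_finite_sums_bound[OF this norm_ge_zero]
  have "bounded_linear (\<lambda>h. Abs_ell2 (?g h))"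
    by (rule bounded_linear_intro[where K = 1])
       (use g in \<open>auto intro!: ell2_eqI simp: ell2_apply_simps\<close>)
  then show ?thesis by (simp add: ell2_single_def bounded_linear_Blinfun_apply g(1))
qed

lemma ell2_single_bop: "ell2_single j \<in> bop"
  by (rule bopI) (auto intro!: ell2_eqI simp: ell2_apply_simps)

lemma cinner_zero_left [simp]: "cinner (0::'a::complex_inner) x = 0"
  using cinner_add_left[of 0 0 x] by simp

lemma adj_ell2_single:
  "adj (ell2_single j :: 'a::complex_hilbert \<Rightarrow>\<^sub>L ('i, 'a) ell2) = ell2_eval j"
proof (rule adj_eqI)
  fix h :: 'a and f :: "('i, 'a) ell2"
  have "cinner (blinfun_apply (ell2_single j) h) f =
      (\<Sum>\<^sub>\<infinity>x. cinner (if x = j then h else 0) (ell2_apply f x))"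
    by (simp add: cinner_ell2.rep_eq)
  also have "\<dots> = (\<Sum>\<^sub>\<infinity>x\<in>{j}. cinner h (ell2_apply f x))"
    by (rule infsum_cong_neutral) auto
  finally show "cinner (blinfun_apply (ell2_single j) h) f = cinner h (blinfun_apply (ell2_eval j) f)"
    by simp
qed

lemma isometry_ell2_single: "isometry_op (ell2_single j)"
  unfolding isometry_op_def
  by (simp add: ell2_single_bop cinner_adj[OF ell2_single_bop] adj_ell2_single)

lemma compression_ell2_single:
  "blinfun_apply (compression (ell2_single j) a) h =
    ell2_apply (blinfun_apply a (blinfun_apply (ell2_single j) h)) j"
  by (simp add: compression_eq[OF isometry_ell2_single] adj_ell2_single)

text \<open>
  The formula is an operator only for bounded weights \<open>c\<close> and injective \<open>\<tau>\<close>; these are the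
  assumptions under which it is evaluated below.
\<close>

definition weighted_composition ::
    "('i \<Rightarrow> 'a::complex_hilbert \<Rightarrow>\<^sub>L 'a) \<Rightarrow> ('i \<Rightarrow> 'i) \<Rightarrow> ('i, 'a) ell2 \<Rightarrow>\<^sub>L ('i, 'a) ell2" where
  "weighted_composition c \<tau> =
    Blinfun (\<lambda>f. Abs_ell2 (\<lambda>x. blinfun_apply (c x) (ell2_apply f (\<tau> x))))"

lemma weighted_composition_apply:
  fixes c :: "'i \<Rightarrow> 'a::complex_hilbert \<Rightarrow>\<^sub>L 'a"
  assumes C: "\<And>x. norm (c x) \<le> C" and inj: "inj \<tau>"
  shows "ell2_apply (blinfun_apply (weighted_composition c \<tau>) f) x =
    blinfun_apply (c x) (ell2_apply f (\<tau> x))"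
proof -
  let ?g = "\<lambda>f x. blinfun_apply (c x) (ell2_apply f (\<tau> x))"
  have C0: "0 \<le> C" using order_trans[OF norm_ge_zero C] .
  have "(\<Sum>x\<in>F. (norm (?g f x))\<^sup>2) \<le> (norm f * C)\<^sup>2" if "finite F" for F f
  proof -
    have "norm (?g f x) \<le> C * norm (ell2_apply f (\<tau> x))" for x
      using norm_blinfun[of "c x"] mult_right_mono[OF C norm_ge_zero] order_trans by blast
    then have "(\<Sum>x\<in>F. (norm (?g f x))\<^sup>2) \<le> (\<Sum>x\<in>F. C\<^sup>2 * (norm (ell2_apply f (\<tau> x)))\<^sup>2)"
      by (intro sum_mono) (simp add: power_mono flip: power_mult_distrib)
    also have "\<dots> = C\<^sup>2 * (\<Sum>y\<in>\<tau> ` F. (norm (ell2_apply f y))\<^sup>2)"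
      by (subst sum.reindex) (auto simp: sum_distrib_left inj_on_subset[OF inj])
    also have "\<dots> \<le> C\<^sup>2 * (norm f)\<^sup>2"
      by (intro mult_left_mono sum_le_norm_ell2) (use that in auto)
    finally show ?thesis by (simp add: power_mult_distrib mult.commute)
  qed
  note g = ell2_finite_sums_bound[OF this mult_nonneg_nonneg[OF norm_ge_zero C0]]
  have "bounded_linear (\<lambda>f. Abs_ell2 (?g f))"
  proof (rule bounded_linear_intro[where K = C])
    show "Abs_ell2 (?g (f + h)) = Abs_ell2 (?g f) + Abs_ell2 (?g h)" for f h
      by (rule ell2_eqI, simp only: g(1), simp add: ell2_apply_simps)
         (simp add: g(1) blinfun.bilinear_simps)
    show "Abs_ell2 (?g (r *\<^sub>R f)) = r *\<^sub>R Abs_ell2 (?g f)" for r f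
      by (rule ell2_eqI, simp only: g(1), simp add: ell2_apply_simps)
         (simp add: g(1) blinfun.bilinear_simps)
  qed (rule g(2))
  then show ?thesis by (simp add: weighted_composition_def bounded_linear_Blinfun_apply g(1))
qed

lemma weighted_composition_bop:
  fixes c :: "'i \<Rightarrow> 'a::complex_hilbert \<Rightarrow>\<^sub>L 'a"
  assumes "\<And>x. norm (c x) \<le> C" "inj \<tau>" "\<And>x. c x \<in> bop"
  shows "weighted_composition c \<tau> \<in> bop"
  by (rule bopI, rule ell2_eqI)
     (simp add: weighted_composition_apply[OF assms(1,2)] ell2_apply_simps bopD[OF assms(3)])

lemma adj_weighted_composition:
  fixes c :: "'i \<Rightarrow> 'a::complex_hilbert \<Rightarrow>\<^sub>L 'a"
  assumes C: "\<And>x. norm (c x) \<le> C" and c: "\<And>x. c x \<in> bop"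
    and inv: "\<And>x. \<sigma> (\<tau> x) = x" "\<And>x. \<tau> (\<sigma> x) = x"
  shows "adj (weighted_composition c \<tau>) = weighted_composition (\<lambda>x. adj (c (\<sigma> x))) \<sigma>"
proof (rule adj_eqI)
  fix f g
  have inj: "inj \<tau>" "inj \<sigma>" by (metis injI inv)+
  have bij: "bij_betw \<tau> UNIV UNIV" by (metis bij_betw_def inj(1) inv(2) surj_def)
  have C': "norm (adj (c (\<sigma> x))) \<le> C" for x
    using norm_adj_le[OF c] C order_trans by blast
  have "cinner (blinfun_apply (weighted_composition c \<tau>) f) g =
      (\<Sum>\<^sub>\<infinity>x. cinner (ell2_apply f (\<tau> x)) (blinfun_apply (adj (c (\<sigma> (\<tau> x)))) (ell2_apply g (\<sigma> (\<tau> x)))))"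
    by (simp add: cinner_ell2.rep_eq weighted_composition_apply[OF C inj(1)] cinner_adj[OF c] inv)
  also have "\<dots> = (\<Sum>\<^sub>\<infinity>y. cinner (ell2_apply f y) (blinfun_apply (adj (c (\<sigma> y))) (ell2_apply g (\<sigma> y))))"
    by (rule infsum_reindex_bij_betw[OF bij])
  finally show "cinner (blinfun_apply (weighted_composition c \<tau>) f) g =
      cinner f (blinfun_apply (weighted_composition (\<lambda>x. adj (c (\<sigma> x))) \<sigma>) g)"
    by (simp add: cinner_ell2.rep_eq weighted_composition_apply[OF C' inj(2)])
qed

section \<open>The Schaeffer unitary in one coordinate\<close>

text \<open>
  The Schaeffer matrix of a contraction \<open>T\<close> acts on families \<open>h\<close> indexed by \<open>m :: int\<close>.  With
  \<open>D = defect T\<close> and \<open>E = defect (adj T)\<close> it is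
  \<open>(S h)\<^sub>0 = T h\<^sub>0 + E h\<^sub>-\<^sub>1\<close>, \<open>(S h)\<^sub>1 = D h\<^sub>0 - T\<^sup>* h\<^sub>-\<^sub>1\<close> and \<open>(S h)\<^sub>m = h\<^sub>m\<^sub>-\<^sub>1\<close> otherwise: the bilateral shift,
  with a unitary \<open>2 \<times> 2\<close> block inserted where it passes from \<open>{-1, 0}\<close> to \<open>{0, 1}\<close>.  In row \<open>m\<close>
  all entries outside the columns \<open>m - 1\<close> and \<open>- m\<close> vanish, and shift and flip are bijections; so \<open>S\<close>
  is a sum of two weighted compositions.  In a family indexed by several integers it acts on the
  coordinate \<open>i\<close>.
\<close>

definition shift_coeff :: "('a::complex_hilbert \<Rightarrow>\<^sub>L 'a) \<Rightarrow> int \<Rightarrow> 'a \<Rightarrow>\<^sub>L 'a" where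
  "shift_coeff T m = (if m = 0 then defect (adj T) else if m = 1 then defect T else id_blinfun)"

definition flip_coeff :: "('a::complex_hilbert \<Rightarrow>\<^sub>L 'a) \<Rightarrow> int \<Rightarrow> 'a \<Rightarrow>\<^sub>L 'a" where
  "flip_coeff T m = (if m = 0 then T else if m = 1 then - adj T else 0)"

definition schaeffer ::
    "'i \<Rightarrow> ('a::complex_hilbert \<Rightarrow>\<^sub>L 'a) \<Rightarrow> ('i \<Rightarrow> int, 'a) ell2 \<Rightarrow>\<^sub>L ('i \<Rightarrow> int, 'a) ell2" where
  "schaeffer i T =
    weighted_composition (\<lambda>x. shift_coeff T (x i)) (\<lambda>x. x(i := x i - 1)) +
    weighted_composition (\<lambda>x. flip_coeff T (x i)) (\<lambda>x. x(i := - x i))"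

context
  fixes T :: "'a::complex_hilbert \<Rightarrow>\<^sub>L 'a"
  assumes T: "T \<in> bop" and T1: "norm T \<le> 1"
begin

lemma defect_bop: "defect T \<in> bop" "defect (adj T) \<in> bop"
  using defect_generated[OF T T1] defect_adj_generated[OF T T1]
    cstar_bop[OF unital_cstar_algebra_generated[OF T]] by blast+

lemma adj_defect_adj: "adj (defect (adj T)) = defect (adj T)"
  by (rule adj_defect[OF adj_contraction[OF T T1]])

lemma defect_adj_square: "defect (adj T) o\<^sub>L defect (adj T) = id_blinfun - (T o\<^sub>L adj T)"
  using defect_square[OF adj_contraction[OF T T1]] by (simp add: T)

lemma defect_adj_intertwine: "adj T o\<^sub>L defect (adj T) = defect T o\<^sub>L adj T"
  using defect_intertwine[OF adj_contraction[OF T T1]] by (simp add: T)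

lemma coeff_bop: "shift_coeff T m \<in> bop" "flip_coeff T m \<in> bop"
  by (simp_all add: shift_coeff_def flip_coeff_def defect_bop T bop_minus)

lemma coeff_generated:
  "shift_coeff T m \<in> cstar_generated T" "flip_coeff T m \<in> cstar_generated T"
  using defect_generated[OF T T1] defect_adj_generated[OF T T1] cstar_generated_self[of T]
    unital_cstar_algebra_generated[OF T] cstar_scaleR[of _ "adj T" "-1"]
  by (auto simp: shift_coeff_def flip_coeff_def cstar_id cstar_zero cstar_adj)

lemma coeff_bounded: "\<exists>C. \<forall>m. norm (shift_coeff T m) \<le> C" "\<exists>C. \<forall>m. norm (flip_coeff T m) \<le> C"
proof -
  let ?C = "norm (defect (adj T)) + norm (defect T) + norm (id_blinfun :: 'a \<Rightarrow>\<^sub>L 'a)"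
  have "norm (shift_coeff T m) \<le> ?C" for m
    by (simp add: shift_coeff_def)
  then show "\<exists>C. \<forall>m. norm (shift_coeff T m) \<le> C" by blast
  have "norm (flip_coeff T m) \<le> 1" for m
    using T1 adj_contraction[OF T T1] by (simp add: flip_coeff_def)
  then show "\<exists>C. \<forall>m. norm (flip_coeff T m) \<le> C" by blast
qed

lemma inj_update: "inj (\<lambda>x :: 'i \<Rightarrow> int. x(i := x i - 1))" "inj (\<lambda>x :: 'i \<Rightarrow> int. x(i := - x i))"
  by (rule inj_on_inverseI[where g = "\<lambda>x. x(i := x i + 1)"], simp)
     (rule inj_on_inverseI[where g = "\<lambda>x. x(i := - x i)"], simp)

lemma schaeffer_apply:
  "ell2_apply (blinfun_apply (schaeffer i T) f) x =
    blinfun_apply (shift_coeff T (x i)) (ell2_apply f (x(i := x i - 1))) +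
    blinfun_apply (flip_coeff T (x i)) (ell2_apply f (x(i := - x i)))"
proof -
  obtain C C' where "\<And>m. norm (shift_coeff T m) \<le> C" "\<And>m. norm (flip_coeff T m) \<le> C'"
    using coeff_bounded by blast
  from weighted_composition_apply[of "\<lambda>x. shift_coeff T (x i)", OF this(1) inj_update(1)]
    weighted_composition_apply[of "\<lambda>x. flip_coeff T (x i)", OF this(2) inj_update(2)]
  show ?thesis
    by (simp add: schaeffer_def blinfun.bilinear_simps plus_ell2.rep_eq)
qed

lemma schaeffer_bop: "schaeffer i T \<in> bop"
  by (rule bopI, rule ell2_eqI)
     (simp add: schaeffer_apply ell2_apply_simps bopD[OF coeff_bop(1)] bopD[OF coeff_bop(2)]
       scaleC_add_right)

lemma adj_schaeffer_apply:
  fixes i :: 'i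
  shows "ell2_apply (blinfun_apply (adj (schaeffer i T)) f) x =
    blinfun_apply (adj (shift_coeff T (x i + 1))) (ell2_apply f (x(i := x i + 1))) +
    blinfun_apply (adj (flip_coeff T (- x i))) (ell2_apply f (x(i := - x i)))"
proof -
  obtain C C' where C: "\<And>m. norm (shift_coeff T m) \<le> C" "\<And>m. norm (flip_coeff T m) \<le> C'"
    using coeff_bounded by blast
  note bop = weighted_composition_bop[of "\<lambda>x. shift_coeff T (x i)", OF C(1) inj_update(1) coeff_bop(1)]
    weighted_composition_bop[of "\<lambda>x. flip_coeff T (x i)", OF C(2) inj_update(2) coeff_bop(2)]
  have 1: "adj (weighted_composition (\<lambda>x. shift_coeff T (x i)) (\<lambda>x. x(i := x i - 1))) =
      weighted_composition (\<lambda>x. adj (shift_coeff T (x i + 1))) (\<lambda>x. x(i := x i + 1))"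
    by (subst adj_weighted_composition[OF C(1) coeff_bop(1), where \<sigma> = "\<lambda>x. x(i := x i + 1)"]) simp_all
  have 2: "adj (weighted_composition (\<lambda>x. flip_coeff T (x i)) (\<lambda>x. x(i := - x i))) =
      weighted_composition (\<lambda>x. adj (flip_coeff T (- x i))) (\<lambda>x. x(i := - x i))"
    by (subst adj_weighted_composition[OF C(2) coeff_bop(2), where \<sigma> = "\<lambda>x. x(i := - x i)"]) simp_all
  have inj: "inj (\<lambda>x :: 'i \<Rightarrow> int. x(i := x i + 1))"
    by (rule inj_on_inverseI[where g = "\<lambda>x. x(i := x i - 1)"]) simp
  have C': "norm (adj (shift_coeff T m)) \<le> C" "norm (adj (flip_coeff T m)) \<le> C'" for m
    using norm_adj_le[OF coeff_bop(1)[of m]] norm_adj_le[OF coeff_bop(2)[of m]] C order_trans by blast+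
  from weighted_composition_apply[of "\<lambda>x. adj (shift_coeff T (x i + 1))", OF this(1) inj]
    weighted_composition_apply[of "\<lambda>x. adj (flip_coeff T (- x i))", OF this(2) inj_update(2)]
  show ?thesis
    by (simp add: schaeffer_def adj_add bop 1 2 blinfun.bilinear_simps plus_ell2.rep_eq)
qed

text \<open>
  A row of \<open>S\<^sup>* S\<close> or \<open>S S\<^sup>*\<close> has two entries that can be nonzero: the diagonal one, and one at the
  index reached by a shift and a flip.  They are \<open>1\<close> because \<open>D\<^sup>2 = 1 - T\<^sup>* T\<close> and
  \<open>E\<^sup>2 = 1 - T T\<^sup>*\<close>, and \<open>0\<close> because \<open>T D = E T\<close>.
\<close>

lemma coeff_diagonal:
  "(adj (shift_coeff T (m + 1)) o\<^sub>L shift_coeff T (m + 1)) +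
    (adj (flip_coeff T (- m)) o\<^sub>L flip_coeff T (- m)) = id_blinfun"
  "(shift_coeff T m o\<^sub>L adj (shift_coeff T m)) +
    (flip_coeff T m o\<^sub>L adj (flip_coeff T m)) = id_blinfun"
  by (auto simp: shift_coeff_def flip_coeff_def adj_defect[OF T T1] adj_defect_adj defect_adj_square
      defect_square[OF T T1] adj_minus T blinfun_compose_distribs)

lemma coeff_off_diagonal:
  "(adj (shift_coeff T (m + 1)) o\<^sub>L flip_coeff T (m + 1)) +
    (adj (flip_coeff T (- m)) o\<^sub>L shift_coeff T (- m)) = 0"
  "(shift_coeff T m o\<^sub>L adj (flip_coeff T (1 - m))) +
    (flip_coeff T m o\<^sub>L adj (shift_coeff T (1 - m))) = 0"
  by (auto simp: shift_coeff_def flip_coeff_def adj_defect[OF T T1] adj_defect_adj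
      defect_adj_intertwine defect_intertwine[OF T T1] adj_minus T blinfun_compose_distribs)

lemma unitary_schaeffer:
  fixes i :: 'i
  shows "unitary_op (schaeffer i T)"
  unfolding unitary_op_def
proof (intro conjI schaeffer_bop blinfun_eqI ell2_eqI)
  fix f :: "('i \<Rightarrow> int, 'a) ell2" and x :: "'i \<Rightarrow> int"
  let ?u = "ell2_apply f x" and ?m = "x i"
  let ?v = "ell2_apply f (x(i := - ?m - 1))" and ?w = "ell2_apply f (x(i := 1 - ?m))"
  have "ell2_apply (blinfun_apply (adj (schaeffer i T) o\<^sub>L schaeffer i T) f) x =
    blinfun_apply ((adj (shift_coeff T (?m + 1)) o\<^sub>L shift_coeff T (?m + 1)) +
      (adj (flip_coeff T (- ?m)) o\<^sub>L flip_coeff T (- ?m))) ?u +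
    blinfun_apply ((adj (shift_coeff T (?m + 1)) o\<^sub>L flip_coeff T (?m + 1)) +
      (adj (flip_coeff T (- ?m)) o\<^sub>L shift_coeff T (- ?m))) ?v"
    by (simp add: schaeffer_apply adj_schaeffer_apply blinfun.bilinear_simps)
  then show "ell2_apply (blinfun_apply (adj (schaeffer i T) o\<^sub>L schaeffer i T) f) x =
      ell2_apply (blinfun_apply id_blinfun f) x"
    by (simp only: coeff_diagonal coeff_off_diagonal blinfun_apply_id_blinfun blinfun.zero_left
        add_0_right id_apply)
  have "ell2_apply (blinfun_apply (schaeffer i T o\<^sub>L adj (schaeffer i T)) f) x =
    blinfun_apply ((shift_coeff T ?m o\<^sub>L adj (shift_coeff T ?m)) +
      (flip_coeff T ?m o\<^sub>L adj (flip_coeff T ?m))) ?u +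
    blinfun_apply ((shift_coeff T ?m o\<^sub>L adj (flip_coeff T (1 - ?m))) +
      (flip_coeff T ?m o\<^sub>L adj (shift_coeff T (1 - ?m)))) ?w"
    by (simp add: schaeffer_apply adj_schaeffer_apply blinfun.bilinear_simps)
  then show "ell2_apply (blinfun_apply (schaeffer i T o\<^sub>L adj (schaeffer i T)) f) x =
      ell2_apply (blinfun_apply id_blinfun f) x"
    by (simp only: coeff_diagonal coeff_off_diagonal blinfun_apply_id_blinfun blinfun.zero_left
        add_0_right id_apply)
qed

text \<open>
  Families supported on \<open>m \<ge> 0\<close> in coordinate \<open>i\<close> are invariant under the Schaeffer operator, which
  acts on their entries at \<open>0\<close> as \<open>T\<close>; its adjoint does the same for \<open>m \<le> 0\<close> and \<open>T\<^sup>*\<close>.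
  Families supported on \<open>m = 0\<close> are both.
\<close>

lemma schaeffer_halfline:
  assumes "\<And>m. m < 0 \<Longrightarrow> ell2_apply f (x(i := m)) = 0"
  shows "m < 0 \<Longrightarrow> ell2_apply (blinfun_apply (schaeffer i T) f) (x(i := m)) = 0"
    and "ell2_apply (blinfun_apply (schaeffer i T) f) (x(i := 0)) =
      blinfun_apply T (ell2_apply f (x(i := 0)))"
  using assms[of "m - 1"] assms[of "-1"] by (auto simp: schaeffer_apply flip_coeff_def)

lemma adj_schaeffer_halfline:
  assumes "\<And>m. m > 0 \<Longrightarrow> ell2_apply f (x(i := m)) = 0"
  shows "m > 0 \<Longrightarrow> ell2_apply (blinfun_apply (adj (schaeffer i T)) f) (x(i := m)) = 0"
    and "ell2_apply (blinfun_apply (adj (schaeffer i T)) f) (x(i := 0)) =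
      blinfun_apply (adj T) (ell2_apply f (x(i := 0)))"
  using assms[of "m + 1"] assms[of 1] by (auto simp: adj_schaeffer_apply flip_coeff_def)

lemma op_power_schaeffer:
  assumes "\<And>m. m < 0 \<Longrightarrow> ell2_apply f (x(i := m)) = 0"
  shows "(\<forall>m<0. ell2_apply (blinfun_apply (op_power (schaeffer i T) k) f) (x(i := m)) = 0) \<and>
    ell2_apply (blinfun_apply (op_power (schaeffer i T) k) f) (x(i := 0)) =
      blinfun_apply (op_power T k) (ell2_apply f (x(i := 0)))"
proof (induction k)
  case (Suc k)
  then show ?case
    using schaeffer_halfline[of "blinfun_apply (op_power (schaeffer i T) k) f" x i]
    unfolding op_power.simps blinfun_apply_blinfun_compose by metis
qed (simp add: assms del: fun_upd_apply)

lemma op_power_adj_schaeffer: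
  assumes "\<And>m. m > 0 \<Longrightarrow> ell2_apply f (x(i := m)) = 0"
  shows "(\<forall>m>0. ell2_apply (blinfun_apply (op_power (adj (schaeffer i T)) k) f) (x(i := m)) = 0) \<and>
    ell2_apply (blinfun_apply (op_power (adj (schaeffer i T)) k) f) (x(i := 0)) =
      blinfun_apply (op_power (adj T) k) (ell2_apply f (x(i := 0)))"
proof (induction k)
  case (Suc k)
  then show ?case
    using adj_schaeffer_halfline[of "blinfun_apply (op_power (adj (schaeffer i T)) k) f" x i]
    unfolding op_power.simps blinfun_apply_blinfun_compose by metis
qed (simp add: assms del: fun_upd_apply)

lemma star_power_schaeffer:
  assumes "\<And>m. m \<noteq> 0 \<Longrightarrow> ell2_apply f (x(i := m)) = 0"
  shows "ell2_apply (blinfun_apply (star_power (schaeffer i T) k) f) (x(i := 0)) =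
    blinfun_apply (star_power T k) (ell2_apply f (x(i := 0)))"
  using op_power_schaeffer[of f x i] op_power_adj_schaeffer[of f x i] assms
  by (simp add: star_power_def)

lemma star_power_schaeffer_support:
  assumes "l \<noteq> i" "\<And>x. x l \<noteq> 0 \<Longrightarrow> ell2_apply f x = 0" "x l \<noteq> 0"
  shows "ell2_apply (blinfun_apply (star_power (schaeffer i T) k) f) x = 0"
proof -
  have "\<forall>x. x l \<noteq> 0 \<longrightarrow> ell2_apply (blinfun_apply (op_power (schaeffer i T) j) f) x = 0" for j
    by (induction j) (use assms in \<open>simp_all add: schaeffer_apply \<close>)
  moreover
  have "\<forall>x. x l \<noteq> 0 \<longrightarrow> ell2_apply (blinfun_apply (op_power (adj (schaeffer i T)) j) f) x = 0" for j
    by (induction j) (use assms in \<open>simp_all add: adj_schaeffer_apply \<close>)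
  ultimately show ?thesis using assms(3) by (simp add: star_power_def)
qed

end

text \<open>
  The index maps of different coordinates commute, and so do the coefficients, which lie in the
  algebras generated by \<open>T\<close> and by \<open>S\<close>.
\<close>

lemma schaeffer_commute:
  assumes T: "T \<in> bop" "norm T \<le> 1" and S: "S \<in> bop" "norm S \<le> 1" and ij: "i \<noteq> j"
    and comm: "\<And>a b. a \<in> cstar_generated T \<Longrightarrow> b \<in> cstar_generated S \<Longrightarrow> a o\<^sub>L b = b o\<^sub>L a"
  shows "schaeffer i T o\<^sub>L schaeffer j S = schaeffer j S o\<^sub>L schaeffer i T"
proof (rule blinfun_eqI, rule ell2_eqI)
  fix f x
  have c: "blinfun_apply a (blinfun_apply b h) = blinfun_apply b (blinfun_apply a h)"
    if "a \<in> cstar_generated T" "b \<in> cstar_generated S" for a b h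
    using comm[OF that] by (metis blinfun_apply_blinfun_compose)
  show "ell2_apply (blinfun_apply (schaeffer i T o\<^sub>L schaeffer j S) f) x =
      ell2_apply (blinfun_apply (schaeffer j S o\<^sub>L schaeffer i T) f) x"
    using ij
    by (simp add: schaeffer_apply T S blinfun.bilinear_simps
        c[OF coeff_generated(1)[OF T] coeff_generated(1)[OF S]]
        c[OF coeff_generated(1)[OF T] coeff_generated(2)[OF S]]
        c[OF coeff_generated(2)[OF T] coeff_generated(1)[OF S]]
        c[OF coeff_generated(2)[OF T] coeff_generated(2)[OF S]]
        fun_upd_twist[OF ij])
qed

section \<open>Algebras generated by a unitary, and commutation\<close>

inductive_set power_span :: "('a::complex_hilbert \<Rightarrow>\<^sub>L 'a) \<Rightarrow> ('a \<Rightarrow>\<^sub>L 'a) set"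
  for U :: "'a \<Rightarrow>\<^sub>L 'a" where
  power: "star_power U k \<in> power_span U"
| add: "a \<in> power_span U \<Longrightarrow> b \<in> power_span U \<Longrightarrow> a + b \<in> power_span U"
| scale: "a \<in> power_span U \<Longrightarrow> c *\<^sub>C a \<in> power_span U"

lemma power_span_bop: "a \<in> power_span U \<Longrightarrow> U \<in> bop \<Longrightarrow> a \<in> bop"
  by (induction rule: power_span.induct) (auto intro: star_power_bop bop_add bop_scaleC)

lemma power_span_compose:
  assumes U: "unitary_op U" and "a \<in> power_span U" "b \<in> power_span U"
  shows "a o\<^sub>L b \<in> power_span U"
  using assms(2)
proof (induction rule: power_span.induct)
  case (power k)
  show ?case using assms(3)
  proof (induction rule: power_span.induct)
    case (power l)
    then show ?case by (metis power_span.power star_power_unitary_add[OF U])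
  qed (auto simp: blinfun_compose_distribs compose_scaleC star_power_bop unitary_bop[OF U]
      intro: power_span.intros)
qed (auto simp: blinfun_compose_distribs compose_scaleC intro: power_span.intros)

lemma power_span_adj:
  assumes U: "U \<in> bop" and "a \<in> power_span U"
  shows "adj a \<in> power_span U"
  using assms(2)
  by (induction rule: power_span.induct)
     (auto simp: adj_star_power[OF U] adj_add adj_scaleC power_span_bop[OF _ U]
       intro: power_span.intros)

lemma unital_cstar_algebra_closure_power_span:
  assumes U: "unitary_op U"
  shows "unital_cstar_algebra (closure (power_span U))"
proof -
  let ?L = "power_span U"
  have sub: "closure ?L \<subseteq> bop"
    by (rule closure_minimal) (auto intro: power_span_bop unitary_bop[OF U] closed_bop)
  have binary: "f a b \<in> closure ?L"
    if f: "\<And>X Y. X \<longlonglongrightarrow> a \<Longrightarrow> Y \<longlonglongrightarrow> b \<Longrightarrow> (\<lambda>k. f (X k) (Y k)) \<longlonglongrightarrow> f a b"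
      and L: "\<And>x y. x \<in> ?L \<Longrightarrow> y \<in> ?L \<Longrightarrow> f x y \<in> ?L"
      and ab: "a \<in> closure ?L" "b \<in> closure ?L" for f a b
  proof -
    obtain X where X: "\<And>k. X k \<in> ?L" "X \<longlonglongrightarrow> a"
      using ab(1) unfolding closure_sequential by blast
    obtain Y where Y: "\<And>k. Y k \<in> ?L" "Y \<longlonglongrightarrow> b"
      using ab(2) unfolding closure_sequential by blast
    show ?thesis
      unfolding closure_sequential
      by (intro exI[of _ "\<lambda>k. f (X k) (Y k)"]) (simp add: f[OF X(2) Y(2)] L X(1) Y(1))
  qed
  have "adj a \<in> closure ?L" if a: "a \<in> closure ?L" for a
  proof -
    obtain X where X: "\<And>k. X k \<in> ?L" "X \<longlonglongrightarrow> a"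
      using a unfolding closure_sequential by blast
    have "(\<lambda>k. adj (X k)) \<longlonglongrightarrow> adj a"
      using X sub a by (intro tendsto_adj) (auto intro: power_span_bop[OF X(1) unitary_bop[OF U]])
    then show ?thesis
      unfolding closure_sequential
      by (intro exI[of _ "\<lambda>k. adj (X k)"]) (simp add: power_span_adj[OF unitary_bop[OF U]] X(1))
  qed
  moreover have "id_blinfun \<in> closure ?L"
    using power_span.power[of U 0] closure_subset[of ?L] by auto
  moreover have "a + b \<in> closure ?L" "a o\<^sub>L b \<in> closure ?L" "c *\<^sub>C a \<in> closure ?L"
    if "a \<in> closure ?L" "b \<in> closure ?L" for a b c
  proof -
    show "a + b \<in> closure ?L"
      by (rule binary[where f = "(+)"]) (use that in \<open>auto intro: tendsto_add power_span.add\<close>)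
    show "a o\<^sub>L b \<in> closure ?L"
      by (rule binary[where f = "(o\<^sub>L)"])
         (use that in \<open>auto intro: tendsto_compose power_span_compose[OF U]\<close>)
    show "c *\<^sub>C a \<in> closure ?L"
      by (rule binary[where f = "\<lambda>a b. c *\<^sub>C a"])
         (use that in \<open>auto intro: tendsto_scaleC_blinfun power_span.scale\<close>)
  qed
  ultimately show ?thesis using sub by (simp add: unital_cstar_algebra_def)
qed

text \<open>
  For a unitary, \<open>U\<^sup>* = U\<^sup>-\<^sup>1\<close> makes the linear span of the integer powers a *-algebra, so
  properties of \<open>cstar_generated U\<close> that are linear and closed need only be checked on powers.
\<close>

lemma cstar_generated_unitary_subset:
  assumes U: "unitary_op U" and M: "closed M" "\<And>k. star_power U k \<in> M"
    "\<And>a b. a \<in> M \<Longrightarrow> b \<in> M \<Longrightarrow> a + b \<in> M" "\<And>c a. a \<in> M \<Longrightarrow> c *\<^sub>C a \<in> M"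
  shows "cstar_generated U \<subseteq> M"
proof -
  have "U \<in> power_span U" using power_span.power[of U 1] by simp
  then have "cstar_generated U \<subseteq> closure (power_span U)"
    using closure_subset[of "power_span U"] unital_cstar_algebra_closure_power_span[OF U]
    by (intro cstar_generated_minimal) auto
  moreover have "a \<in> power_span U \<Longrightarrow> a \<in> M" for a
    by (induction rule: power_span.induct) (auto intro: M)
  then have "closure (power_span U) \<subseteq> M"
    by (intro closure_minimal M(1)) auto
  ultimately show ?thesis by blast
qed

text \<open>Commuting with \<open>adj R\<close> as well is what makes the commutant of \<open>R\<close> closed under adjoints.\<close>

lemma unital_cstar_algebra_commutant:
  assumes R: "R \<in> bop"
  shows "unital_cstar_algebra {a\<in>bop. a o\<^sub>L R = R o\<^sub>L a \<and> a o\<^sub>L adj R = adj R o\<^sub>L a}"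
    (is "unital_cstar_algebra ?C")
proof -
  have "closed {a. a o\<^sub>L S = S o\<^sub>L a}" for S :: "'a \<Rightarrow>\<^sub>L 'a"
    by (intro closed_Collect_eq bounded_bilinear.continuous_on[OF bounded_bilinear_blinfun_compose]
        continuous_intros)
  then have "closed (bop \<inter> ({a. a o\<^sub>L R = R o\<^sub>L a} \<inter> {a. a o\<^sub>L adj R = adj R o\<^sub>L a}))"
    by (intro closed_Int closed_bop)
  also have "\<dots> = ?C" by auto
  finally have "closed ?C" .
  moreover have "adj a \<in> ?C" if "a \<in> ?C" for a
    using that R
    by auto (metis adj_adj adj_compose adj_bop)+
  moreover have "a o\<^sub>L b \<in> ?C" if "a \<in> ?C" "b \<in> ?C" for a b
    using that by (simp add: bop_compose) (metis compose_assoc)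
  ultimately show ?thesis
    using R
    by (auto simp: unital_cstar_algebra_def bop_add bop_scaleC blinfun_compose_distribs
        compose_scaleC)
qed

lemma cstar_generated_commute:
  assumes T: "T \<in> bop" and S: "S \<in> bop"
    and comm: "T o\<^sub>L S = S o\<^sub>L T" "T o\<^sub>L adj S = adj S o\<^sub>L T"
    and a: "a \<in> cstar_generated T" and b: "b \<in> cstar_generated S"
  shows "a o\<^sub>L b = b o\<^sub>L a"
proof -
  have "cstar_generated T \<subseteq> {a\<in>bop. a o\<^sub>L S = S o\<^sub>L a \<and> a o\<^sub>L adj S = adj S o\<^sub>L a}"
    using T comm by (intro cstar_generated_minimal unital_cstar_algebra_commutant S) auto
  then have aS: "a \<in> bop" "a o\<^sub>L S = S o\<^sub>L a" "a o\<^sub>L adj S = adj S o\<^sub>L a" using a by auto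
  have "S o\<^sub>L adj a = adj a o\<^sub>L S"
    using arg_cong[OF aS(3), of adj] by (simp add: adj_compose aS(1) S)
  then have "cstar_generated S \<subseteq> {b\<in>bop. b o\<^sub>L a = a o\<^sub>L b \<and> b o\<^sub>L adj a = adj a o\<^sub>L b}"
    using S aS by (intro cstar_generated_minimal unital_cstar_algebra_commutant) auto
  then show ?thesis using b by auto
qed

lemma unitary_commute_adj:
  assumes "unitary_op S" "T o\<^sub>L S = S o\<^sub>L T"
  shows "T o\<^sub>L adj S = adj S o\<^sub>L T"
proof -
  have "T o\<^sub>L adj S = (adj S o\<^sub>L S) o\<^sub>L (T o\<^sub>L adj S)"
    by (simp add: unitary_adj_left[OF assms(1)])
  also have "\<dots> = adj S o\<^sub>L (T o\<^sub>L S) o\<^sub>L adj S"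
    by (simp only: assms(2) compose_assoc)
  also have "\<dots> = adj S o\<^sub>L T"
    by (simp add: compose_assoc unitary_adj_right[OF assms(1)])
  finally show ?thesis .
qed

section \<open>Compressions and products over coordinates\<close>

lemma compression_add:
  "isometry_op V \<Longrightarrow> compression V (a + b) = compression V a + compression V b"
  and compression_scaleC: "isometry_op V \<Longrightarrow> compression V (c *\<^sub>C a) = c *\<^sub>C compression V a"
  by (simp_all add: compression_eq blinfun_compose_distribs compose_scaleC isometry_bop)

lemma compression_bop: "isometry_op V \<Longrightarrow> a \<in> bop \<Longrightarrow> compression V a \<in> bop"
  by (simp add: compression_eq bop_compose isometry_bop)

lemma tendsto_compression:
  "isometry_op V \<Longrightarrow> (X \<longlongrightarrow> a) F \<Longrightarrow> ((\<lambda>k. compression V (X k)) \<longlongrightarrow> compression V a) F"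
  unfolding compression_eq by (intro tendsto_intros)

text \<open>
  Positivity of \<open>\<phi> \<circ> compression V\<close>: \<open>V\<^sup>* a\<^sup>* a V = (a V)\<^sup>* (a V)\<close>, where \<open>a V\<close> leaves the
  domain of \<open>\<phi>\<close> but can be replaced by an operator in it.
\<close>

lemma op_state_compression:
  assumes V: "isometry_op V" and \<phi>: "op_state \<phi>"
  shows "op_state (\<phi> \<circ> compression V)"
  unfolding op_state_def
proof (intro conjI ballI allI)
  fix a b :: "'b \<Rightarrow>\<^sub>L 'b" and c assume a: "a \<in> bop"
  show "(\<phi> \<circ> compression V) (c *\<^sub>C a) = c * (\<phi> \<circ> compression V) a"
    using \<phi> compression_bop[OF V a] by (simp add: compression_scaleC[OF V] op_state_def)
  have "compression V (adj a o\<^sub>L a) = adj (a o\<^sub>L V) o\<^sub>L (a o\<^sub>L V)"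
    by (simp add: compression_eq[OF V] adj_compose a isometry_bop[OF V] compose_assoc)
  moreover obtain d :: "'a \<Rightarrow>\<^sub>L 'a"
    where "d \<in> bop" "adj (a o\<^sub>L V) o\<^sub>L (a o\<^sub>L V) = adj d o\<^sub>L d"
    using adj_compose_self_factor[OF bop_compose[OF a isometry_bop[OF V]]] by blast
  ultimately show "(\<phi> \<circ> compression V) (adj a o\<^sub>L a) \<in> \<real>\<^sub>\<ge>\<^sub>0"
    using \<phi> by (simp add: op_state_def)
  show "(\<phi> \<circ> compression V) (a + b) = (\<phi> \<circ> compression V) a + (\<phi> \<circ> compression V) b"
    if "b \<in> bop"
    using \<phi> compression_bop[OF V a] compression_bop[OF V that]
    by (simp add: compression_add[OF V] op_state_def)
next
  show "(\<phi> \<circ> compression V) id_blinfun = 1"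
    using \<phi> by (simp add: compression_eq[OF V] adj_isometry[OF V] op_state_def)
qed

text \<open>The copy of the original space inside the dilation space sits at the index \<open>0\<close>.\<close>

abbreviation vacuum :: "'a::complex_hilbert \<Rightarrow>\<^sub>L ('i \<Rightarrow> int, 'a) ell2" where
  "vacuum \<equiv> ell2_single (\<lambda>_. 0)"

text \<open>
  Operators built from \<open>schaeffer i T\<close> are matrices in coordinate \<open>i\<close> with entries in the algebra
  generated by \<open>T\<close>.  Instead of infinite matrices only two consequences are recorded, both of which are
  preserved by sums and norm limits: the entry at \<open>(0, 0)\<close> determines the value at \<open>x i = 0\<close> on
  families concentrated there, and concentration at \<open>0\<close> in any other coordinate \<open>l\<close> is preserved.
\<close>

definition coordinate_ops ::
    "'i \<Rightarrow> ('a::complex_hilbert \<Rightarrow>\<^sub>L 'a) set \<Rightarrow> (('i \<Rightarrow> int, 'a) ell2 \<Rightarrow>\<^sub>L ('i \<Rightarrow> int, 'a) ell2) set"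
  where "coordinate_ops i A = {a. compression vacuum a \<in> A \<and>
    (\<forall>f x. x i = 0 \<longrightarrow> (\<forall>m. m \<noteq> 0 \<longrightarrow> ell2_apply f (x(i := m)) = 0) \<longrightarrow>
      ell2_apply (blinfun_apply a f) x = blinfun_apply (compression vacuum a) (ell2_apply f x)) \<and>
    (\<forall>l f. l \<noteq> i \<longrightarrow> (\<forall>x. x l \<noteq> 0 \<longrightarrow> ell2_apply f x = 0) \<longrightarrow>
      (\<forall>x. x l \<noteq> 0 \<longrightarrow> ell2_apply (blinfun_apply a f) x = 0))}"

lemma coordinate_opsD:
  assumes "a \<in> coordinate_ops i A"
  shows "compression vacuum a \<in> A"
    and "x i = 0 \<Longrightarrow> (\<And>m. m \<noteq> 0 \<Longrightarrow> ell2_apply f (x(i := m)) = 0) \<Longrightarrow>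
      ell2_apply (blinfun_apply a f) x = blinfun_apply (compression vacuum a) (ell2_apply f x)"
    and "l \<noteq> i \<Longrightarrow> (\<And>x. x l \<noteq> 0 \<Longrightarrow> ell2_apply f x = 0) \<Longrightarrow> x l \<noteq> 0 \<Longrightarrow>
      ell2_apply (blinfun_apply a f) x = 0"
  using assms unfolding coordinate_ops_def by blast+

lemma closed_coordinate_ops:
  fixes i :: 'i and A :: "('a::complex_hilbert \<Rightarrow>\<^sub>L 'a) set"
  assumes "closed A"
  shows "closed (coordinate_ops i A)"
proof (unfold closed_sequential_limits, intro allI impI, elim conjE)
  fix X a
  assume X: "\<forall>k. X k \<in> coordinate_ops i A" and lim: "X \<longlonglongrightarrow> a"
  have C: "(\<lambda>k. compression vacuum (X k)) \<longlonglongrightarrow> compression vacuum a"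
    by (rule tendsto_compression[OF isometry_ell2_single lim])
  have ev: "(\<lambda>k. ell2_apply (blinfun_apply (X k) f) x) \<longlonglongrightarrow> ell2_apply (blinfun_apply a f) x" for f x
    using bounded_linear.tendsto[OF blinfun.bounded_linear_right, of _ _ _ "ell2_eval x"]
      blinfun.tendsto[OF lim tendsto_const] by force
  show "a \<in> coordinate_ops i A"
    unfolding coordinate_ops_def
  proof (intro CollectI conjI allI impI)
    show "compression vacuum a \<in> A"
      using closed_sequentially[OF assms _ C] X by (simp add: coordinate_ops_def)
  next
    fix f :: "('i \<Rightarrow> int, 'a) ell2" and x :: "'i \<Rightarrow> int"
    assume "x i = 0" "\<forall>m. m \<noteq> 0 \<longrightarrow> ell2_apply f (x(i := m)) = 0"
    then have eq: "ell2_apply (blinfun_apply (X k) f) x =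
        blinfun_apply (compression vacuum (X k)) (ell2_apply f x)" for k
      using X unfolding coordinate_ops_def by blast
    have "(\<lambda>k. ell2_apply (blinfun_apply (X k) f) x) \<longlonglongrightarrow>
        blinfun_apply (compression vacuum a) (ell2_apply f x)"
      unfolding eq by (intro blinfun.tendsto C tendsto_const)
    then show "ell2_apply (blinfun_apply a f) x =
        blinfun_apply (compression vacuum a) (ell2_apply f x)"
      using ev LIMSEQ_unique by blast
  next
    fix l and f :: "('i \<Rightarrow> int, 'a) ell2" and x :: "'i \<Rightarrow> int"
    assume "l \<noteq> i" "\<forall>x. x l \<noteq> 0 \<longrightarrow> ell2_apply f x = 0" "x l \<noteq> 0"
    then have eq: "ell2_apply (blinfun_apply (X k) f) x = 0" for k
      using X unfolding coordinate_ops_def by blast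
    show "ell2_apply (blinfun_apply a f) x = 0"
      using ev[of f x] unfolding eq by (simp add: LIMSEQ_const_iff)
  qed
qed

lemma coordinate_ops_linear:
  assumes A: "unital_cstar_algebra A"
  shows "a \<in> coordinate_ops i A \<Longrightarrow> b \<in> coordinate_ops i A \<Longrightarrow> a + b \<in> coordinate_ops i A"
    and "a \<in> coordinate_ops i A \<Longrightarrow> c *\<^sub>C a \<in> coordinate_ops i A"
  unfolding coordinate_ops_def
  by (auto simp: compression_add compression_scaleC isometry_ell2_single blinfun.bilinear_simps
      ell2_apply_simps cstar_add[OF A] cstar_scaleC[OF A])

lemma compression_star_power_schaeffer:
  assumes "T \<in> bop" "norm T \<le> 1"
  shows "compression vacuum (star_power (schaeffer i T) k) = star_power T k"
proof (rule blinfun_eqI)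
  fix h :: 'a
  have "((\<lambda>_. 0)(i := m)) \<noteq> (\<lambda>_. 0)" if "m \<noteq> 0" for m :: int
    using that by (metis fun_upd_same)
  then show "blinfun_apply (compression vacuum (star_power (schaeffer i T) k)) h =
      blinfun_apply (star_power T k) h"
    using star_power_schaeffer[OF assms, of "blinfun_apply vacuum h" "\<lambda>_. 0" i k]
    by (simp add: compression_ell2_single fun_upd_idem del: fun_upd_apply)
qed

lemma cstar_generated_schaeffer:
  fixes i :: 'i and T :: "'a::complex_hilbert \<Rightarrow>\<^sub>L 'a"
  assumes T: "T \<in> bop" "norm T \<le> 1"
  shows "cstar_generated (schaeffer i T) \<subseteq> coordinate_ops i (cstar_generated T)"
proof (rule cstar_generated_unitary_subset[OF unitary_schaeffer[OF T]])
  note A = unital_cstar_algebra_generated[OF T(1)]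
  show "closed (coordinate_ops i (cstar_generated T))"
    by (rule closed_coordinate_ops[OF cstar_closed[OF A]])
  show "star_power (schaeffer i T) k \<in> coordinate_ops i (cstar_generated T)" for k
    unfolding coordinate_ops_def mem_Collect_eq compression_star_power_schaeffer[OF T]
  proof (intro conjI allI impI)
    show "star_power T k \<in> cstar_generated T"
      by (rule cstar_star_power[OF A cstar_generated_self])
  next
    fix f :: "('i \<Rightarrow> int, 'a) ell2" and x :: "'i \<Rightarrow> int"
    assume "x i = 0" "\<forall>m. m \<noteq> 0 \<longrightarrow> ell2_apply f (x(i := m)) = 0"
    then show "ell2_apply (blinfun_apply (star_power (schaeffer i T) k) f) x =
        blinfun_apply (star_power T k) (ell2_apply f x)"
      using star_power_schaeffer[OF T, of f x i k] by (metis fun_upd_idem)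
  qed (rule star_power_schaeffer_support[OF T], auto)
qed (rule coordinate_ops_linear[OF unital_cstar_algebra_generated[OF T(1)]], assumption+)+

text \<open>
  Compression to the vacuum is not multiplicative, but it is on products of operators in different
  coordinates: each factor sees a family that is concentrated at \<open>0\<close> in its own coordinate.
\<close>

lemma compression_coordinate_product:
  assumes "distinct js" "\<And>i. i \<in> set js \<Longrightarrow> a i \<in> coordinate_ops i (A i)"
  shows "(\<forall>l x. l \<notin> set js \<longrightarrow> x l \<noteq> 0 \<longrightarrow>
      ell2_apply (blinfun_apply (foldr (\<lambda>i b. a i o\<^sub>L b) js id_blinfun) (blinfun_apply vacuum h)) x = 0) \<and>
    ell2_apply (blinfun_apply (foldr (\<lambda>i b. a i o\<^sub>L b) js id_blinfun) (blinfun_apply vacuum h)) (\<lambda>_. 0) =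
      blinfun_apply (foldr (\<lambda>i b. compression vacuum (a i) o\<^sub>L b) js id_blinfun) h"
  using assms
proof (induction js)
  case Nil
  then show ?case by auto
next
  case (Cons i js)
  let ?f = "blinfun_apply (foldr (\<lambda>i b. a i o\<^sub>L b) js id_blinfun) (blinfun_apply vacuum h)"
  have IH: "\<And>l x. l \<notin> set js \<Longrightarrow> x l \<noteq> 0 \<Longrightarrow> ell2_apply ?f x = 0"
    "ell2_apply ?f (\<lambda>_. 0) =
      blinfun_apply (foldr (\<lambda>i b. compression vacuum (a i) o\<^sub>L b) js id_blinfun) h"
    using Cons by auto
  have a: "a i \<in> coordinate_ops i (A i)" and i: "i \<notin> set js" using Cons by auto
  have "ell2_apply (blinfun_apply (a i) ?f) x = 0" if "l \<notin> set (i # js)" "x l \<noteq> 0" for l x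
    using that by (intro coordinate_opsD(3)[OF a, of l] IH(1)[of l]) auto
  moreover have "ell2_apply ?f ((\<lambda>_. 0)(i := m)) = 0" if "m \<noteq> 0" for m
    using IH(1)[OF i] that by (metis fun_upd_same)
  then have "ell2_apply (blinfun_apply (a i) ?f) (\<lambda>_. 0) =
      blinfun_apply (compression vacuum (a i)) (ell2_apply ?f (\<lambda>_. 0))"
    by (intro coordinate_opsD(2)[OF a]) auto
  ultimately show ?case by (simp add: IH(2))
qed

lemma compression_oprod:
  assumes "\<And>i. i \<in> {1..n} \<Longrightarrow> a i \<in> coordinate_ops i (A i)"
  shows "compression vacuum (oprod n a) = oprod n (\<lambda>i. compression vacuum (a i))"
proof (rule blinfun_eqI)
  fix h
  show "blinfun_apply (compression vacuum (oprod n a)) h =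
      blinfun_apply (oprod n (\<lambda>i. compression vacuum (a i))) h"
    using compression_coordinate_product[of "[1..<Suc n]" a A h] assms
    by (simp add: oprod_def compression_ell2_single del: upt_Suc)
qed

lemma oprod_cong: "(\<And>i. i \<in> {1..n} \<Longrightarrow> a i = b i) \<Longrightarrow> oprod n a = oprod n b"
  unfolding oprod_def by (rule foldr_cong) auto

section \<open>Existence of the dilation\<close>

text \<open>
  Since compression to the vacuum is multiplicative across coordinates and maps the algebra of
  \<open>schaeffer i (T i)\<close> into that of \<open>T i\<close>, the independence of the \<open>T i\<close> is inherited directly; the
  dilation equation is the same multiplicativity for powers.
\<close>

theorem tensor_dilation_exists:
  fixes \<phi> :: "('h::complex_hilbert \<Rightarrow>\<^sub>L 'h) \<Rightarrow> complex"
  assumes \<phi>: "op_state \<phi>" and T: "\<And>i. i \<in> {1..n} \<Longrightarrow> T i \<in> bop \<and> norm (T i) \<le> 1"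
    and indep: "tensor_independent \<phi> n T"
  shows "tensor_dilation \<phi> n T vacuum (\<lambda>i. schaeffer i (T i))"
proof -
  let ?U = "\<lambda>i. schaeffer i (T i)"
  have Tb: "T i \<in> bop" and Tn: "norm (T i) \<le> 1" if "i \<in> {1..n}" for i using T[OF that] by auto
  have U: "unitary_op (?U i)" if "i \<in> {1..n}" for i
    by (rule unitary_schaeffer[OF Tb[OF that] Tn[OF that]])
  have gen: "a \<in> coordinate_ops i (cstar_generated (T i))"
    if "i \<in> {1..n}" "a \<in> cstar_generated (?U i)" for i a
    by (rule subsetD[OF cstar_generated_schaeffer[OF Tb[OF that(1)] Tn[OF that(1)]] that(2)])
  have "a o\<^sub>L b = b o\<^sub>L a"
    if ij: "i \<in> {1..n}" "j \<in> {1..n}" "i \<noteq> j"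
      and ab: "a \<in> cstar_generated (?U i)" "b \<in> cstar_generated (?U j)" for i j a b
  proof -
    have "a o\<^sub>L b = b o\<^sub>L a" if "a \<in> cstar_generated (T i)" "b \<in> cstar_generated (T j)" for a b
      using indep ij that unfolding tensor_independent_def by blast
    then have UU: "?U i o\<^sub>L ?U j = ?U j o\<^sub>L ?U i"
      using ij by (intro schaeffer_commute Tb Tn) auto
    show ?thesis
      using ij by (intro cstar_generated_commute[OF _ _ UU unitary_commute_adj[OF _ UU] ab]
          unitary_bop U)
  qed
  moreover have "(\<phi> \<circ> compression vacuum) (oprod n a) = (\<Prod>i\<in>{1..n}. (\<phi> \<circ> compression vacuum) (a i))"
    if a: "\<forall>i\<in>{1..n}. a i \<in> cstar_generated (?U i)" for a
  proof -
    have "compression vacuum (oprod n a) = oprod n (\<lambda>i. compression vacuum (a i))"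
      by (rule compression_oprod[where A = "\<lambda>i. cstar_generated (T i)"]) (use gen a in auto)
    moreover have "compression vacuum (a i) \<in> cstar_generated (T i)" if "i \<in> {1..n}" for i
      using coordinate_opsD(1)[OF gen[OF that]] a that by blast
    ultimately show ?thesis
      using indep unfolding tensor_independent_def by simp
  qed
  ultimately have "tensor_independent (\<phi> \<circ> compression vacuum) n ?U"
    unfolding tensor_independent_def by blast
  moreover have "oprod n (\<lambda>i. star_power (T i) (k i)) =
      compression vacuum (oprod n (\<lambda>i. op_zpower (?U i) (k i)))" for k
  proof -
    have "oprod n (\<lambda>i. star_power (T i) (k i)) =
        oprod n (\<lambda>i. compression vacuum (star_power (?U i) (k i)))"
      by (rule oprod_cong) (simp add: compression_star_power_schaeffer Tb Tn)
    also have "\<dots> = compression vacuum (oprod n (\<lambda>i. star_power (?U i) (k i)))"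
    proof (rule compression_oprod[symmetric, where A = "\<lambda>i. cstar_generated (T i)"])
      show "star_power (?U i) (k i) \<in> coordinate_ops i (cstar_generated (T i))" if "i \<in> {1..n}" for i
        using that by (intro gen cstar_star_power unital_cstar_algebra_generated
            cstar_generated_self unitary_bop U)
    qed
    also have "oprod n (\<lambda>i. star_power (?U i) (k i)) = oprod n (\<lambda>i. op_zpower (?U i) (k i))"
      by (rule oprod_cong) (simp add: op_zpower_unitary U)
    finally show ?thesis .
  qed
  ultimately show ?thesis
    unfolding tensor_dilation_def
    by (intro conjI ballI allI isometry_ell2_single op_state_compression \<phi> U)
qed

section \<open>Unitaries from isometric graphs\<close>

text \<open>
  A nonempty relation between two Hilbert spaces that is linear, norm-preserving and closed is the graph of
  an isometry between closed subspaces.  The conditions are symmetric in the two spaces.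
\<close>

definition isometric_graph :: "('k::complex_hilbert \<Rightarrow> 'l::complex_hilbert \<Rightarrow> bool) \<Rightarrow> bool" where
  "isometric_graph P \<longleftrightarrow>
    (\<forall>x y x' y'. P x y \<longrightarrow> P x' y' \<longrightarrow> P (x + x') (y + y')) \<and>
    (\<forall>c x y. P x y \<longrightarrow> P (c *\<^sub>C x) (c *\<^sub>C y)) \<and>
    (\<forall>x y. P x y \<longrightarrow> norm x = norm y) \<and>
    (\<forall>X Y x y. (\<forall>k::nat. P (X k) (Y k)) \<longrightarrow> X \<longlonglongrightarrow> x \<longrightarrow> Y \<longlonglongrightarrow> y \<longrightarrow> P x y)"

lemma isometric_graph_add: "isometric_graph P \<Longrightarrow> P x y \<Longrightarrow> P x' y' \<Longrightarrow> P (x + x') (y + y')"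
  and isometric_graph_scaleC: "isometric_graph P \<Longrightarrow> P x y \<Longrightarrow> P (c *\<^sub>C x) (c *\<^sub>C y)"
  and isometric_graph_norm: "isometric_graph P \<Longrightarrow> P x y \<Longrightarrow> norm x = norm y"
  by (simp_all add: isometric_graph_def)

lemma isometric_graph_closed:
  assumes "isometric_graph P" "\<And>k::nat. P (X k) (Y k)" "X \<longlonglongrightarrow> x" "Y \<longlonglongrightarrow> y"
  shows "P x y"
proof -
  have "(\<forall>k. P (X k) (Y k)) \<longrightarrow> X \<longlonglongrightarrow> x \<longrightarrow> Y \<longlonglongrightarrow> y \<longrightarrow> P x y"
    using assms(1) unfolding isometric_graph_def by (elim conjE allE)
  with assms(2-4) show ?thesis by simp
qed

lemma isometric_graph_converse:
  assumes P: "isometric_graph P"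
  shows "isometric_graph (\<lambda>y x. P x y)"
  unfolding isometric_graph_def
proof (intro conjI allI impI)
  show "P x y" if "\<forall>k. P (X k) (Y k)" "Y \<longlonglongrightarrow> y" "X \<longlonglongrightarrow> x" for X Y x y
    using isometric_graph_closed[OF P] that by metis
qed (simp_all add: isometric_graph_add[OF P] isometric_graph_scaleC[OF P] isometric_graph_norm[OF P])

lemma isometric_graph_scaleR: "isometric_graph P \<Longrightarrow> P x y \<Longrightarrow> P (r *\<^sub>R x) (r *\<^sub>R y)"
  by (simp add: scaleR_scaleC isometric_graph_scaleC)

lemma isometric_graph_diff: "isometric_graph P \<Longrightarrow> P x y \<Longrightarrow> P x' y' \<Longrightarrow> P (x - x') (y - y')"
  using isometric_graph_add[of P x y "(-1) *\<^sub>R x'" "(-1) *\<^sub>R y'"]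
    isometric_graph_scaleR[of P x' y' "-1"] by simp

lemma isometric_graph_functional:
  assumes P: "isometric_graph P" and "P x y" "P x y'"
  shows "y = y'"
  using isometric_graph_norm[OF P isometric_graph_diff[OF P assms(2,3)]] by simp

lemma closed_domain_isometric_graph:
  assumes P: "isometric_graph P"
  shows "closed {x. \<exists>y. P x y}"
proof (unfold closed_sequential_limits, intro allI impI, elim conjE)
  fix X x assume "\<forall>k. X k \<in> {x. \<exists>y. P x y}" and lim: "X \<longlonglongrightarrow> x"
  then obtain Y where Y: "\<And>k. P (X k) (Y k)" by (simp, metis)
  have "dist (Y j) (Y k) = dist (X j) (X k)" for j k
    using isometric_graph_norm[OF P isometric_graph_diff[OF P Y[of j] Y[of k]]]
    by (simp add: dist_norm)
  then have "Cauchy Y"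
    using LIMSEQ_imp_Cauchy[OF lim] by (simp add: Cauchy_def)
  then obtain y where "Y \<longlonglongrightarrow> y" using Cauchy_convergent convergent_def by blast
  with isometric_graph_closed[OF P Y lim] show "x \<in> {x. \<exists>y. P x y}" by blast
qed

lemma isometric_graph_blinfun:
  assumes P: "isometric_graph P" and total: "\<And>x. \<exists>y. P x y"
  obtains \<Theta> where "\<Theta> \<in> bop" "\<And>x. P x (blinfun_apply \<Theta> x)"
proof -
  obtain F where F: "\<And>x. P x (F x)" using total by metis
  note eqI = isometric_graph_functional[OF P F]
  have "bounded_linear F"
  proof (rule bounded_linear_intro[where K = 1])
    show "F (x + y) = F x + F y" for x y
      by (rule eqI) (rule isometric_graph_add[OF P F F])
    show "F (r *\<^sub>R x) = r *\<^sub>R F x" for r x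
      by (rule eqI) (rule isometric_graph_scaleR[OF P F])
    show "norm (F x) \<le> norm x * 1" for x
      using isometric_graph_norm[OF P F, of x] by simp
  qed
  then have app: "blinfun_apply (Blinfun F) = F" by (rule bounded_linear_Blinfun_apply)
  have "F (c *\<^sub>C x) = c *\<^sub>C F x" for c x
    by (rule eqI) (rule isometric_graph_scaleC[OF P F])
  then have "Blinfun F \<in> bop" by (intro bopI) (simp add: app)
  then show thesis using that F app by metis
qed

lemma isometric_graph_unitary:
  assumes P: "isometric_graph P" and "\<And>x. \<exists>y. P x y" "\<And>y. \<exists>x. P x y"
  obtains \<Theta> where "unitary_op \<Theta>" "\<And>x y. P x y \<Longrightarrow> blinfun_apply \<Theta> x = y"
proof -
  obtain \<Theta> where \<Theta>: "\<Theta> \<in> bop" "\<And>x. P x (blinfun_apply \<Theta> x)"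
    using isometric_graph_blinfun[OF P assms(2)] by blast
  obtain W where W: "\<And>y. P (blinfun_apply W y) y"
    using isometric_graph_blinfun[OF isometric_graph_converse[OF P] assms(3)] by blast
  have eq: "blinfun_apply \<Theta> x = y" if "P x y" for x y
    by (rule isometric_graph_functional[OF P \<Theta>(2) that])
  have eq': "blinfun_apply W y = x" if "P x y" for x y
    by (rule isometric_graph_functional[OF isometric_graph_converse[OF P] W that])
  have inner: "inner (blinfun_apply \<Theta> x) y = inner x (blinfun_apply W y)" for x y
    using isometric_graph_norm[OF P isometric_graph_add[OF P \<Theta>(2) W], of x y]
      isometric_graph_norm[OF P \<Theta>(2), of x] isometric_graph_norm[OF P W, of y]
    by (simp add: dot_norm)
  have "adj \<Theta> = W"
    by (rule adj_eqI) (rule cinner_eqI_inner, use inner bopD[OF \<Theta>(1)] in auto)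
  moreover have "W o\<^sub>L \<Theta> = id_blinfun" by (rule blinfun_eqI) (simp add: eq' \<Theta>(2))
  moreover have "\<Theta> o\<^sub>L W = id_blinfun" by (rule blinfun_eqI) (simp add: eq W)
  ultimately have "unitary_op \<Theta>" using \<Theta>(1) by (simp add: unitary_op_def)
  then show thesis using that eq by blast
qed

inductive_set pair_span :: "('k::complex_hilbert \<times> 'l::complex_hilbert) set \<Rightarrow> ('k \<times> 'l) set"
  for S :: "('k \<times> 'l) set" where
  base: "p \<in> S \<Longrightarrow> p \<in> pair_span S"
| add: "(x, y) \<in> pair_span S \<Longrightarrow> (x', y') \<in> pair_span S \<Longrightarrow> (x + x', y + y') \<in> pair_span S"
| scale: "(x, y) \<in> pair_span S \<Longrightarrow> (c *\<^sub>C x, c *\<^sub>C y) \<in> pair_span S"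

lemma pair_span_cinner:
  assumes S: "\<And>p q. p \<in> S \<Longrightarrow> q \<in> S \<Longrightarrow> cinner (fst p) (fst q) = cinner (snd p) (snd q)"
    and "p \<in> pair_span S" "q \<in> pair_span S"
  shows "cinner (fst p) (fst q) = cinner (snd p) (snd q)"
proof -
  have *: "cinner (fst p) (fst q) = cinner (snd p) (snd q)" if "q \<in> S" for q
    using assms(2)
    by (induction rule: pair_span.induct) (use that S in \<open>auto simp: cinner_add_left cinner_scaleC_left\<close>)
  show ?thesis
    using assms(3)
    by (induction rule: pair_span.induct) (auto simp: * cinner_add_right cinner_scaleC_right)
qed

lemma closure_pair_span_sequential:
  "(x, y) \<in> closure (pair_span S) \<longleftrightarrow>
    (\<exists>X Y. (\<forall>k. (X k, Y k) \<in> pair_span S) \<and> X \<longlonglongrightarrow> x \<and> Y \<longlonglongrightarrow> y)"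
proof
  assume "(x, y) \<in> closure (pair_span S)"
  then obtain Z where "\<forall>k. Z k \<in> pair_span S" "Z \<longlonglongrightarrow> (x, y)"
    unfolding closure_sequential by blast
  then show "\<exists>X Y. (\<forall>k. (X k, Y k) \<in> pair_span S) \<and> X \<longlonglongrightarrow> x \<and> Y \<longlonglongrightarrow> y"
    using tendsto_fst[of Z "(x, y)"] tendsto_snd[of Z "(x, y)"]
    by (intro exI[of _ "\<lambda>k. fst (Z k)"] exI[of _ "\<lambda>k. snd (Z k)"]) simp
next
  assume "\<exists>X Y. (\<forall>k. (X k, Y k) \<in> pair_span S) \<and> X \<longlonglongrightarrow> x \<and> Y \<longlonglongrightarrow> y"
  then obtain X Y where "\<forall>k. (X k, Y k) \<in> pair_span S" "X \<longlonglongrightarrow> x" "Y \<longlonglongrightarrow> y" by blast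
  then show "(x, y) \<in> closure (pair_span S)"
    unfolding closure_sequential
    by (intro exI[of _ "\<lambda>k. (X k, Y k)"]) (simp add: tendsto_Pair)
qed

text \<open>
  Families with the same Gram matrix generate a norm-preserving relation; closing it up gives the
  graph of the isometry that matches them.
\<close>

lemma isometric_graph_closure_pair_span:
  fixes S :: "('k::complex_hilbert \<times> 'l::complex_hilbert) set"
  assumes S: "\<And>p q. p \<in> S \<Longrightarrow> q \<in> S \<Longrightarrow> cinner (fst p) (fst q) = cinner (snd p) (snd q)"
  shows "isometric_graph (\<lambda>x y. (x, y) \<in> closure (pair_span S))"
  unfolding isometric_graph_def
proof (intro conjI allI impI)
  fix x y x' y' assume "(x, y) \<in> closure (pair_span S)" "(x', y') \<in> closure (pair_span S)"
  then obtain X Y X' Y' where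
    "\<And>k. (X k, Y k) \<in> pair_span S" "X \<longlonglongrightarrow> x" "Y \<longlonglongrightarrow> y"
    "\<And>k. (X' k, Y' k) \<in> pair_span S" "X' \<longlonglongrightarrow> x'" "Y' \<longlonglongrightarrow> y'"
    unfolding closure_pair_span_sequential by metis
  then show "(x + x', y + y') \<in> closure (pair_span S)"
    unfolding closure_pair_span_sequential
    by (intro exI[of _ "\<lambda>k. X k + X' k"] exI[of _ "\<lambda>k. Y k + Y' k"])
       (simp add: tendsto_add pair_span.add)
next
  fix c x y assume "(x, y) \<in> closure (pair_span S)"
  then obtain X Y where
    "\<And>k. (X k, Y k) \<in> pair_span S" "X \<longlonglongrightarrow> x" "Y \<longlonglongrightarrow> y"
    unfolding closure_pair_span_sequential by metis
  then show "(c *\<^sub>C x, c *\<^sub>C y) \<in> closure (pair_span S)"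
    unfolding closure_pair_span_sequential
    by (intro exI[of _ "\<lambda>k. c *\<^sub>C X k"] exI[of _ "\<lambda>k. c *\<^sub>C Y k"])
       (simp add: bounded_linear.tendsto[OF bounded_linear_scaleC] pair_span.scale)
next
  fix x y assume xy: "(x, y) \<in> closure (pair_span S)"
  have "norm (fst p) = norm (snd p)" if "p \<in> pair_span S" for p
    using pair_span_cinner[OF S that that]
    by (simp add: cinner_self power2_eq_iff_nonneg del: of_real_power)
  then have "closure (pair_span S) \<subseteq> {p. norm (fst p) = norm (snd p)}"
    by (intro closure_minimal closed_Collect_eq continuous_intros) auto
  then show "norm x = norm y" using xy by auto
next
  fix X Y x y
  assume "\<forall>k. (X k, Y k) \<in> closure (pair_span S)" "X \<longlonglongrightarrow> x" "Y \<longlonglongrightarrow> y"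
  then show "(x, y) \<in> closure (pair_span S)"
    using closed_sequentially[OF closed_closure, of "\<lambda>k. (X k, Y k)" "pair_span S" "(x, y)"]
    by (simp add: tendsto_Pair)
qed

lemma closure_pair_span_invariant:
  assumes S: "\<And>x y. (x, y) \<in> S \<Longrightarrow> (blinfun_apply a x, blinfun_apply b y) \<in> S"
    and ab: "a \<in> bop" "b \<in> bop"
    and xy: "(x, y) \<in> closure (pair_span S)"
  shows "(blinfun_apply a x, blinfun_apply b y) \<in> closure (pair_span S)"
proof -
  have *: "(blinfun_apply a (fst p), blinfun_apply b (snd p)) \<in> pair_span S" if "p \<in> pair_span S" for p
    using that
    by (induction rule: pair_span.induct)
       (use S ab in \<open>auto simp: blinfun.bilinear_simps bopD intro: pair_span.intros\<close>)
  obtain X Y where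
    XY: "\<And>k. (X k, Y k) \<in> pair_span S" "X \<longlonglongrightarrow> x" "Y \<longlonglongrightarrow> y"
    using xy unfolding closure_pair_span_sequential by metis
  have "(blinfun_apply a (X k), blinfun_apply b (Y k)) \<in> pair_span S" for k
    using *[OF XY(1)[of k]] by simp
  moreover have "(\<lambda>k. blinfun_apply a (X k)) \<longlonglongrightarrow> blinfun_apply a x"
    "(\<lambda>k. blinfun_apply b (Y k)) \<longlonglongrightarrow> blinfun_apply b y"
    by (intro blinfun.tendsto tendsto_const XY)+
  ultimately show ?thesis
    unfolding closure_pair_span_sequential
    by (intro exI[of _ "\<lambda>k. blinfun_apply a (X k)"] exI[of _ "\<lambda>k. blinfun_apply b (Y k)"]) simp
qed

section \<open>Products of commuting unitaries\<close>

lemma foldr_compose_commute: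
  fixes X :: "'a::real_normed_vector \<Rightarrow>\<^sub>L 'a"
  assumes "\<And>j. j \<in> set js \<Longrightarrow> X o\<^sub>L A j = A j o\<^sub>L X"
  shows "X o\<^sub>L foldr (\<lambda>i b. A i o\<^sub>L b) js id_blinfun = foldr (\<lambda>i b. A i o\<^sub>L b) js id_blinfun o\<^sub>L X"
  using assms
proof (induction js)
  case (Cons j js)
  let ?F = "foldr (\<lambda>i b. A i o\<^sub>L b) js id_blinfun"
  have "X o\<^sub>L (A j o\<^sub>L ?F) = A j o\<^sub>L (X o\<^sub>L ?F)"
    using Cons.prems[of j] by (simp flip: compose_assoc)
  then show ?case using Cons by (simp add: compose_assoc)
qed simp

lemma foldr_compose_mult:
  fixes A B :: "'i \<Rightarrow> 'a::real_normed_vector \<Rightarrow>\<^sub>L 'a"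
  assumes "distinct js" "\<And>i j. i \<in> set js \<Longrightarrow> j \<in> set js \<Longrightarrow> i \<noteq> j \<Longrightarrow> B i o\<^sub>L A j = A j o\<^sub>L B i"
  shows "foldr (\<lambda>i b. A i o\<^sub>L b) js id_blinfun o\<^sub>L foldr (\<lambda>i b. B i o\<^sub>L b) js id_blinfun =
    foldr (\<lambda>i b. (A i o\<^sub>L B i) o\<^sub>L b) js id_blinfun"
  using assms
proof (induction js)
  case (Cons j js)
  let ?A = "foldr (\<lambda>i b. A i o\<^sub>L b) js id_blinfun" and ?B = "foldr (\<lambda>i b. B i o\<^sub>L b) js id_blinfun"
  have "B j o\<^sub>L ?A = ?A o\<^sub>L B j"
    using Cons.prems by (intro foldr_compose_commute) auto
  then have "(A j o\<^sub>L ?A) o\<^sub>L (B j o\<^sub>L ?B) = (A j o\<^sub>L B j) o\<^sub>L (?A o\<^sub>L ?B)"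
    by (metis compose_assoc)
  then show ?case using Cons by simp
qed simp

lemma oprod_mult:
  assumes "\<And>i j. i \<in> {1..n} \<Longrightarrow> j \<in> {1..n} \<Longrightarrow> i \<noteq> j \<Longrightarrow> B i o\<^sub>L A j = A j o\<^sub>L B i"
  shows "oprod n A o\<^sub>L oprod n B = oprod n (\<lambda>i. A i o\<^sub>L B i)"
  unfolding oprod_def by (rule foldr_compose_mult) (use assms in auto)

lemma oprod_single:
  assumes "i \<in> {1..n}"
  shows "oprod n (\<lambda>j. if j = i then a else id_blinfun) = a"
proof -
  have "foldr (\<lambda>j b. (if j = i then a else id_blinfun) o\<^sub>L b) js id_blinfun =
      (if i \<in> set js then a else id_blinfun)" if "distinct js" for js
    using that by (induction js) auto
  from this[of "[1..<Suc n]"] show ?thesis using assms by (simp add: oprod_def del: upt_Suc)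
qed

lemma oprod_id: "oprod n (\<lambda>_. id_blinfun) = id_blinfun"
proof -
  have "foldr (\<lambda>i b. id_blinfun o\<^sub>L b) js id_blinfun = (id_blinfun :: 'a \<Rightarrow>\<^sub>L 'a)" for js :: "nat list"
    by (induction js) auto
  then show ?thesis by (simp only: oprod_def)
qed

lemma unitary_compose: "unitary_op U \<Longrightarrow> unitary_op W \<Longrightarrow> unitary_op (U o\<^sub>L W)"
proof -
  assume U: "unitary_op U" and W: "unitary_op W"
  have "adj U o\<^sub>L (U o\<^sub>L W) = W" "W o\<^sub>L (adj W o\<^sub>L adj U) = adj U"
    by (simp_all add: unitary_adj_left[OF U] unitary_adj_right[OF W] flip: compose_assoc)
  then show "unitary_op (U o\<^sub>L W)"
    using U W unfolding unitary_op_def by (simp add: adj_compose bop_compose compose_assoc)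
qed

lemma unitary_id: "unitary_op id_blinfun"
  by (simp add: unitary_op_def)

lemma unitary_adj: "unitary_op U \<Longrightarrow> unitary_op (adj U)"
  by (simp add: unitary_op_def)

lemma unitary_star_power: "unitary_op U \<Longrightarrow> unitary_op (star_power U k)"
proof -
  have "unitary_op U \<Longrightarrow> unitary_op (op_power U m)" for U :: "'a \<Rightarrow>\<^sub>L 'a" and m
    by (induction m) (simp_all add: unitary_id unitary_compose)
  then show "unitary_op U \<Longrightarrow> unitary_op (star_power U k)"
    by (simp add: star_power_def unitary_adj)
qed

lemma unitary_oprod:
  assumes "\<And>i. i \<in> {1..n} \<Longrightarrow> unitary_op (A i)"
  shows "unitary_op (oprod n A)"
proof -
  have "(\<forall>i\<in>set js. unitary_op (A i)) \<Longrightarrow> unitary_op (foldr (\<lambda>i b. A i o\<^sub>L b) js id_blinfun)" for js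
    by (induction js) (simp_all add: unitary_id unitary_compose)
  then show ?thesis using assms by (simp add: oprod_def del: upt_Suc)
qed

section \<open>Uniqueness of the minimal dilation\<close>

definition multi_power :: "nat \<Rightarrow> (nat \<Rightarrow> 'a::complex_hilbert \<Rightarrow>\<^sub>L 'a) \<Rightarrow> (nat \<Rightarrow> int) \<Rightarrow> 'a \<Rightarrow>\<^sub>L 'a" where
  "multi_power n U k = oprod n (\<lambda>i. star_power (U i) (k i))"

context
  fixes \<phi> :: "('h::complex_hilbert \<Rightarrow>\<^sub>L 'h) \<Rightarrow> complex" and n T
    and V :: "'h \<Rightarrow>\<^sub>L 'k::complex_hilbert" and U
  assumes dil: "tensor_dilation \<phi> n T V U"
begin

lemma dilation_isometry: "isometry_op V"
  and dilation_unitary: "i \<in> {1..n} \<Longrightarrow> unitary_op (U i)"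
  using dil by (auto simp: tensor_dilation_def)

lemma dilation_powers: "compression V (multi_power n U k) = oprod n (\<lambda>i. star_power (T i) (k i))"
proof -
  have "multi_power n U k = oprod n (\<lambda>i. op_zpower (U i) (k i))"
    unfolding multi_power_def by (rule oprod_cong) (simp add: op_zpower_unitary dilation_unitary)
  then show ?thesis using dil by (simp add: tensor_dilation_def)
qed

lemma multi_power_add: "multi_power n U k o\<^sub>L multi_power n U l = multi_power n U (\<lambda>i. k i + l i)"
proof -
  have gen: "star_power (U i) m \<in> cstar_generated (U i)" if "i \<in> {1..n}" for i m
    by (intro cstar_star_power unital_cstar_algebra_generated cstar_generated_self unitary_bop
        dilation_unitary that)
  have "star_power (U i) p o\<^sub>L star_power (U j) q = star_power (U j) q o\<^sub>L star_power (U i) p"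
    if "i \<in> {1..n}" "j \<in> {1..n}" "i \<noteq> j" for i j p q
    using dil that gen[OF that(1), of p] gen[OF that(2), of q]
    unfolding tensor_dilation_def tensor_independent_def by blast
  then have "multi_power n U k o\<^sub>L multi_power n U l =
      oprod n (\<lambda>i. star_power (U i) (k i) o\<^sub>L star_power (U i) (l i))"
    unfolding multi_power_def by (rule oprod_mult)
  also have "\<dots> = multi_power n U (\<lambda>i. k i + l i)"
    unfolding multi_power_def
    by (rule oprod_cong) (simp add: star_power_unitary_add dilation_unitary)
  finally show ?thesis .
qed

lemma multi_power_0: "multi_power n U (\<lambda>_. 0) = id_blinfun"
  by (simp add: multi_power_def oprod_id)

lemma adj_multi_power: "adj (multi_power n U k) = multi_power n U (\<lambda>i. - k i)"
proof -
  have "unitary_op (multi_power n U k)"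
    unfolding multi_power_def by (intro unitary_oprod unitary_star_power dilation_unitary)
  then have "multi_power n U (\<lambda>i. - k i) =
      adj (multi_power n U k) o\<^sub>L (multi_power n U k o\<^sub>L multi_power n U (\<lambda>i. - k i))"
    by (simp add: unitary_adj_left flip: compose_assoc)
  then show ?thesis by (simp add: multi_power_add multi_power_0)
qed

lemma multi_power_bop: "multi_power n U k \<in> bop"
  unfolding multi_power_def by (intro unitary_bop unitary_oprod unitary_star_power dilation_unitary)

lemma dilation_as_multi_power:
  assumes "i \<in> {1..n}"
  shows "U i = multi_power n U (\<lambda>j. if j = i then 1 else 0)"
    and "adj (U i) = multi_power n U (\<lambda>j. if j = i then -1 else 0)"
proof -
  have "star_power (U j) (if j = i then 1 else 0) = (if j = i then U i else id_blinfun)"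
    "star_power (U j) (if j = i then -1 else 0) = (if j = i then adj (U i) else id_blinfun)" for j
    by auto
  then show "U i = multi_power n U (\<lambda>j. if j = i then 1 else 0)"
    "adj (U i) = multi_power n U (\<lambda>j. if j = i then -1 else 0)"
    by (simp_all only: multi_power_def oprod_single[OF assms])
qed

text \<open>
  For multi-indices \<open>k\<close>, the Gram matrix of the vectors \<open>U\<^sup>k V h\<close> depends only on the compressed operators:
  \<open>(U\<^sup>k)\<^sup>* U\<^sup>l = U\<^sup>l\<^sup>-\<^sup>k\<close> compresses to the prescribed product of powers of the \<open>T i\<close>.
\<close>

lemma dilation_Gram:
  "cinner (blinfun_apply (multi_power n U k) (blinfun_apply V h))
      (blinfun_apply (multi_power n U l) (blinfun_apply V h')) =
    cinner h (blinfun_apply (oprod n (\<lambda>i. star_power (T i) (l i - k i))) h')"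
proof -
  have "adj (multi_power n U k) o\<^sub>L multi_power n U l = multi_power n U (\<lambda>i. l i - k i)"
    by (simp add: adj_multi_power multi_power_add algebra_simps)
  then have "blinfun_apply (adj (multi_power n U k)) (blinfun_apply (multi_power n U l) x) =
      blinfun_apply (multi_power n U (\<lambda>i. l i - k i)) x" for x
    by (metis blinfun_apply_blinfun_compose)
  then show ?thesis
    by (simp add: cinner_adj[OF multi_power_bop] cinner_adj[OF isometry_bop[OF dilation_isometry]]
        compression_eq[OF dilation_isometry] flip: dilation_powers)
qed

end

text \<open>
  The relation matching \<open>U\<^sup>k V h\<close> with \<open>U'\<^sup>k V' h\<close> is isometric since the Gram matrices agree.  Its
  domain and range are reducing and contain the original space, so by minimality they are everything.
\<close>

theorem minimal_dilation_unique:
  fixes V :: "'h::complex_hilbert \<Rightarrow>\<^sub>L 'k::complex_hilbert"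
    and V' :: "'h \<Rightarrow>\<^sub>L 'l::complex_hilbert"
  assumes dil: "tensor_dilation \<phi> n T V U" "tensor_dilation \<phi> n T V' U'"
    and min: "minimal_dilation_space n V U" "minimal_dilation_space n V' U'"
  shows "\<exists>\<Theta> :: 'k \<Rightarrow>\<^sub>L 'l. unitary_op \<Theta> \<and>
    (\<forall>h. blinfun_apply \<Theta> (blinfun_apply V h) = blinfun_apply V' h) \<and>
    (\<forall>i\<in>{1..n}. \<Theta> o\<^sub>L U i = U' i o\<^sub>L \<Theta>)"
proof -
  define S where "S = {(blinfun_apply (multi_power n U k) (blinfun_apply V h),
    blinfun_apply (multi_power n U' k) (blinfun_apply V' h)) | k h. True}"
  define P where "P x y \<longleftrightarrow> (x, y) \<in> closure (pair_span S)" for x y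
  have SI: "(blinfun_apply (multi_power n U k) (blinfun_apply V h),
      blinfun_apply (multi_power n U' k) (blinfun_apply V' h)) \<in> S" for k h
    unfolding S_def by blast
  have P: "isometric_graph P"
    unfolding P_def
    by (rule isometric_graph_closure_pair_span)
       (auto simp: S_def dilation_Gram[OF dil(1)] dilation_Gram[OF dil(2)])
  have PV: "P (blinfun_apply V h) (blinfun_apply V' h)" for h
    using SI[of "\<lambda>_. 0" h] closure_subset[of "pair_span S"] pair_span.base
    by (auto simp: P_def multi_power_0[OF dil(1)] multi_power_0[OF dil(2)])
  have inv: "P (blinfun_apply (multi_power n U l) x) (blinfun_apply (multi_power n U' l) y)"
    if "P x y" for l x y
    unfolding P_def
  proof (rule closure_pair_span_invariant)
    fix x y assume "(x, y) \<in> S"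
    then obtain k h where "x = blinfun_apply (multi_power n U k) (blinfun_apply V h)"
      "y = blinfun_apply (multi_power n U' k) (blinfun_apply V' h)"
      unfolding S_def by blast
    then show "(blinfun_apply (multi_power n U l) x, blinfun_apply (multi_power n U' l) y) \<in> S"
      using SI[of "\<lambda>i. l i + k i" h]
      by (simp flip: multi_power_add[OF dil(1)] multi_power_add[OF dil(2)])
  qed (use that multi_power_bop[OF dil(1)] multi_power_bop[OF dil(2)] in \<open>simp_all add: P_def\<close>)
  have PU: "P (blinfun_apply (U i) x) (blinfun_apply (U' i) y)"
    and PU': "P (blinfun_apply (adj (U i)) x) (blinfun_apply (adj (U' i)) y)"
    if "i \<in> {1..n}" "P x y" for i x y
    using inv[OF that(2)] dilation_as_multi_power[OF dil(1) that(1)]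
      dilation_as_multi_power[OF dil(2) that(1)] by metis+
  have P0: "P 0 0" using PV[of 0] by (simp add: blinfun.bilinear_simps)
  have "reducing_subspace n U {x. \<exists>y. P x y}"
    unfolding reducing_subspace_def
    using closed_domain_isometric_graph[OF P] P0 isometric_graph_add[OF P]
      isometric_graph_scaleC[OF P] PU PU' by blast
  then have "reducing_subspace n U hull range (blinfun_apply V) \<subseteq> {x. \<exists>y. P x y}"
    by (intro hull_minimal) (use PV in auto)
  then have total: "\<exists>y. P x y" for x
    using min(1) by (auto simp: minimal_dilation_space_def)
  have "reducing_subspace n U' {y. \<exists>x. P x y}"
    unfolding reducing_subspace_def
    using closed_domain_isometric_graph[OF isometric_graph_converse[OF P]] P0
      isometric_graph_add[OF P] isometric_graph_scaleC[OF P] PU PU' by blast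
  then have "reducing_subspace n U' hull range (blinfun_apply V') \<subseteq> {y. \<exists>x. P x y}"
    by (intro hull_minimal) (use PV in auto)
  then have onto: "\<exists>x. P x y" for y
    using min(2) by (auto simp: minimal_dilation_space_def)
  obtain \<Theta> where \<Theta>: "unitary_op \<Theta>" "\<And>x y. P x y \<Longrightarrow> blinfun_apply \<Theta> x = y"
    using isometric_graph_unitary[OF P total onto] by blast
  have "\<Theta> o\<^sub>L U i = U' i o\<^sub>L \<Theta>" if "i \<in> {1..n}" for i
  proof (rule blinfun_eqI)
    fix x
    obtain y where "P x y" using total by blast
    then show "blinfun_apply (\<Theta> o\<^sub>L U i) x = blinfun_apply (U' i o\<^sub>L \<Theta>) x"
      using \<Theta>(2) PU[OF that] by simp
  qed
  then show ?thesis using \<Theta> PV by blast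
qed

section \<open>Existence and uniqueness of tensor dilations\<close>

theorem theorem2p2:
  fixes \<phi> :: "('h::complex_hilbert \<Rightarrow>\<^sub>L 'h) \<Rightarrow> complex"
    and n :: nat
    and T :: "nat \<Rightarrow> 'h \<Rightarrow>\<^sub>L 'h"
  assumes "op_state \<phi>"
    and "\<forall>i\<in>{1..n}. T i \<in> bop \<and> norm (T i) \<le> 1"
    and "tensor_independent \<phi> n T"
  shows "(\<exists>(V :: 'h \<Rightarrow>\<^sub>L (nat \<Rightarrow> int, 'h) ell2) U. tensor_dilation \<phi> n T V U) \<and>
    (\<forall>(V :: 'h \<Rightarrow>\<^sub>L 'k::complex_hilbert) U (V' :: 'h \<Rightarrow>\<^sub>L 'l::complex_hilbert) U'.
      tensor_dilation \<phi> n T V U \<and> minimal_dilation_space n V U \<and>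
      tensor_dilation \<phi> n T V' U' \<and> minimal_dilation_space n V' U' \<longrightarrow>
      (\<exists>\<Theta> :: 'k \<Rightarrow>\<^sub>L 'l. unitary_op \<Theta> \<and>
        (\<forall>h. blinfun_apply \<Theta> (blinfun_apply V h) = blinfun_apply V' h) \<and>
        (\<forall>i\<in>{1..n}. \<Theta> o\<^sub>L U i = U' i o\<^sub>L \<Theta>)))"
proof (intro conjI allI impI)
  show "\<exists>(V :: 'h \<Rightarrow>\<^sub>L (nat \<Rightarrow> int, 'h) ell2) U. tensor_dilation \<phi> n T V U"
    using tensor_dilation_exists[OF assms(1) _ assms(3)] assms(2) by blast
qed (rule minimal_dilation_unique, auto)

end
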